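(* Fix a finite field $\mathbb{F}_q$ of characteristic $p$ with algebraic closure $\overline{\mathbb{F}_q}$. For $n\ge1$ let $k=k(n)$ be a positive integer and let $\mathbf{X}=(X_1,\dots,X_n)$ be $\overline{\mathbb{F}_q}$-valued random variables such that $(e_1(\mathbf{X}),\dots,e_n(\mathbf{X}))$ is uniformly distributed on $\mathbb{F}_q^n$. Then, as $n\to\infty$: (1) if $\log k=o(n^2)$, the distribution of $p_k(\mathbf{X})$ tends to the uniform distribution on $\mathbb{F}_q$; (2) if $a_1,\dots,a_k\in\mathbb{F}_q$ with $a_k\neq0$, $p\nmid k$ and $\log k=o(n)$, the distribution of $\sum_{i=1}^k a_i p_i(\mathbf{X})$ tends to the uniform distribution on $\mathbb{F}_q$; (3) if $\sum_{12\log_q n<d\le n,\ \gcd(k,q^d-1)<q^{d/3}} d^{-1}\to\infty$, the distribution of $p_k(\mathbf{X})$ tends to the uniform distribution on $\mathbb{F}_q$.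
   Context: $e_j(t_1,\dots,t_n)=\sum_{1\le j_1<\dots<j_j\le n}t_{j_1}\cdots t_{j_j}$ is the $j$-th elementary symmetric polynomial and $p_k(t_1,\dots,t_n)=\sum_{i=1}^n t_i^k$ is the $k$-th power sum; by Newton's identities $p_k(\mathbf{X})\in\mathbb{F}_q$. *)

theory Defs
  imports
    "HOL-Probability.Probability"
    "HOL-Library.Landau_Symbols"
    "HOL-Algebra.Algebraic_Closure_Type"
begin

definition elem_sym :: "nat \<Rightarrow> nat \<Rightarrow> (nat \<Rightarrow> 'b::comm_ring_1) \<Rightarrow> 'b" where
  "elem_sym j n t = (\<Sum>S | S \<subseteq> {1..n} \<and> card S = j. \<Prod>i\<in>S. t i)"

definition power_sum :: "nat \<Rightarrow> nat \<Rightarrow> (nat \<Rightarrow> 'b::comm_ring_1) \<Rightarrow> 'b" where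
  "power_sum k n t = (\<Sum>i=1..n. t i ^ k)"

(* The finite field is the type 'a itself; this is its copy inside the algebraic closure. *)
definition base_field :: "'a::field alg_closure set" where
  "base_field = range to_ac"

(* The next two notions are meant for finite nonempty A: since the card A point masses
   1 / card A add up to 1, they determine the distribution (resp. its limit) completely. *)
definition uniformly_distributed_on :: "'w measure \<Rightarrow> ('w \<Rightarrow> 'b) \<Rightarrow> 'b set \<Rightarrow> bool" where
  "uniformly_distributed_on M Y A \<longleftrightarrow>
     (\<forall>v\<in>A. measure M {w \<in> space M. Y w = v} = 1 / real (card A))"

definition tends_to_uniform_on ::
    "(nat \<Rightarrow> 'w measure) \<Rightarrow> (nat \<Rightarrow> 'w \<Rightarrow> 'b) \<Rightarrow> 'b set \<Rightarrow> bool" where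
  "tends_to_uniform_on M Y A \<longleftrightarrow>
     (\<forall>v\<in>A. (\<lambda>n. measure (M n) {w \<in> space (M n). Y n w = v}) \<longlonglongrightarrow> 1 / real (card A))"

end

theory Submission
  imports
    Defs
    "HOL-Number_Theory.Residues"
    "HOL-Real_Asymp.Real_Asymp"
begin

hide_const (open) Divisibility.prime Coset.order Polynomials.degree Polynomials.lead_coeff
  up_ring.coeff up_ring.monom module.smult

text \<open>
  Let \<open>q\<close> be the size of the field. The multiset of the \<open>X\<^sub>i\<close> is uniformly distributed on the
  \<open>q ^ n\<close> multisets of size \<open>n\<close> over the algebraic closure that are invariant under Frobenius.
  Removing Frobenius cycles from such a multiset gives, for the distribution \<open>D\<^sub>n\<close> of
  \<open>\<Sum> h(X\<^sub>i)\<close>, the convolution recursion \<open>n D\<^sub>n = \<Sum>\<^sub>m E\<^sub>m * D\<^sub>n\<^sub>-\<^sub>m\<close>, where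
  \<open>E\<^sub>m\<close> is the distribution of the trace of \<open>h(\<alpha>)\<close> for uniform \<open>\<alpha>\<close> in the field of
  size \<open>q ^ m\<close>. A differential inequality for generating functions turns this into a bound of
  order \<open>exp (- (\<Sum> 1/m) / 2)\<close> for the distance of \<open>D\<^sub>n\<close> from uniform, the sum being over those
  \<open>m \<le> n\<close> for which \<open>E\<^sub>m\<close> is close to uniform.

  By Stepanov's method \<open>E\<^sub>m\<close> is close to uniform once \<open>q ^ m\<close> is somewhat larger than the square
  of the degree of \<open>h\<close>, and for \<open>h = x\<^sup>k\<close> the degree may be replaced by \<open>gcd(k, q ^ m - 1)\<close>.
  If these gcds are large for too many odd \<open>m \<le> n\<close>, then their least common multiple, a divisor of
  \<open>k\<close>, exceeds \<open>q ^ (c n\<^sup>2)\<close>, because \<open>gcd(q ^ a - 1, q ^ b - 1) = q ^ gcd(a, b) - 1\<close> is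
  small on average.
\<close>

section \<open>Sequences with a bounded logarithmic derivative\<close>

text \<open>What shapes the last part is a competition of exponents. A degree \<open>d\<close> whose
  gcd is at least \<open>q ^ (d / 3)\<close> contributes that factor to the least common multiple,
  but may share up to \<open>q ^ s(d)\<close> with the smaller degrees, where \<open>s(d)\<close> is
  the sum of the proper divisors of \<open>d\<close>. Over all \<open>d\<close> the average of
  \<open>s(d) / d\<close> is \<open>pi^2 / 6 - 1\<close>, about 0.64, which would eat up the gain of
  1/3. Over odd \<open>d\<close> it is \<open>pi^2 / 8 - 1\<close>, about 0.23, so a positive
  proportion of the gain survives; hence the restriction to odd degrees. On the other side 1/3 is
  below 1/2, the exponent at which Stepanov's bound becomes trivial. Passing from \<open>k\<close>
  to the gcd has a second effect: a divisor of \<open>q ^ m - 1\<close> is prime to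
  \<open>q\<close>, and this coprimality is what separates the degrees in Stepanov's method. Power
  sums can therefore be treated for every \<open>k\<close>. For a degree \<open>m\<close> with
  \<open>E\<^sub>m\<close> close to uniform only a contraction by 1/2 is extracted. This is enough,
  because the aim is merely that the sum of \<open>1/m\<close> over such \<open>m\<close>
  diverges.\<close>

text \<open>For \<open>f(u) = \<Sum> \<Delta>\<^sub>j u\<^sup>j\<close> and \<open>g(u) = \<Sum> t\<^sub>m u\<^sup>m / m\<close> the recursion gives
  \<open>f' \<le> g' f\<close>, so \<open>f exp (- g)\<close> decreases on \<open>[0, 1]\<close>.\<close>

lemma sum_le_exp_of_log_derivative_recursion:
  fixes D t :: "nat \<Rightarrow> real"
  assumes D: "\<And>n. D n \<ge> 0" and t: "\<And>m. t m \<ge> 0"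
    and rec: "\<And>n. real n * D n \<le> (\<Sum>m=1..n. t m * D (n - m))"
  shows "(\<Sum>j\<le>N. D j) \<le> D 0 * exp (\<Sum>m=1..N. t m / real m)"
proof -
  define f where "f = (\<lambda>u::real. \<Sum>j\<le>N. D j * u ^ j)"
  define f' where "f' = (\<lambda>u::real. \<Sum>j=1..N. D j * (real j * u ^ (j - 1)))"
  define g where "g = (\<lambda>u::real. \<Sum>m=1..N. t m / real m * u ^ m)"
  define g' where "g' = (\<lambda>u::real. \<Sum>m=1..N. t m * u ^ (m - 1))"
  have df: "(f has_real_derivative f' u) (at u)" for u
  proof -
    have "(f has_real_derivative (\<Sum>j\<le>N. D j * (real j * u ^ (j - 1)))) (at u)"
      unfolding f_def by (auto intro!: derivative_eq_intros sum.cong)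
    also have "(\<Sum>j\<le>N. D j * (real j * u ^ (j - 1))) = f' u"
      unfolding f'_def by (rule sum.mono_neutral_right) auto
    finally show ?thesis .
  qed
  have dg: "(g has_real_derivative g' u) (at u)" for u
    unfolding g_def g'_def by (auto intro!: derivative_eq_intros sum.cong)
  have key: "f' u \<le> g' u * f u" if u: "u \<ge> 0" for u
  proof -
    have "f' u \<le> (\<Sum>j=1..N. \<Sum>m=1..j. t m * D (j - m) * u ^ (j - 1))"
      unfolding f'_def
    proof (rule sum_mono)
      fix j assume "j \<in> {1..N}"
      have "real j * D j * u ^ (j - 1) \<le> (\<Sum>m=1..j. t m * D (j - m)) * u ^ (j - 1)"
        by (intro mult_right_mono rec) (use u in auto)
      thus "D j * (real j * u ^ (j - 1)) \<le> (\<Sum>m=1..j. t m * D (j - m) * u ^ (j - 1))"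
        unfolding sum_distrib_right by (simp add: mult_ac)
    qed
    also have "\<dots> = (\<Sum>(j,m)\<in>Sigma {1..N} (\<lambda>j. {1..j}). t m * D (j - m) * u ^ (j - 1))"
      by (subst sum.Sigma) auto
    \<comment> \<open>With \<open>i = j - m\<close> the sum runs over a triangle. All terms are
      nonnegative, so it may be enlarged to the full rectangle, which is the product
      \<open>g' u * f u\<close>.\<close>
    also have "\<dots> = (\<Sum>(m,i)\<in>{(m,i). m \<in> {1..N} \<and> i \<le> N \<and> m + i \<le> N}. t m * u ^ (m - 1) * (D i * u ^ i))"
      by (rule sum.reindex_bij_witness[of _ "\<lambda>(m,i). (m + i, m)" "\<lambda>(j,m). (m, j - m)"])
         (auto simp flip: power_add)
    also have "\<dots> \<le> (\<Sum>(m,i)\<in>{1..N} \<times> {..N}. t m * u ^ (m - 1) * (D i * u ^ i))"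
      by (rule sum_mono2) (use u D t in \<open>auto intro!: mult_nonneg_nonneg\<close>)
    also have "\<dots> = g' u * f u"
      by (simp add: g'_def f_def sum_product sum.cartesian_product)
    finally show ?thesis .
  qed
  have "f 1 * exp (- g 1) \<le> f 0 * exp (- g 0)"
  proof (rule DERIV_nonpos_imp_nonincreasing[of 0 1 "\<lambda>u. f u * exp (- g u)"])
    fix u :: real assume u: "0 \<le> u" "u \<le> 1"
    have "((\<lambda>u. f u * exp (- g u)) has_real_derivative (f' u - g' u * f u) * exp (- g u)) (at u)"
      by (auto intro!: derivative_eq_intros df dg simp: algebra_simps)
    moreover have "(f' u - g' u * f u) * exp (- g u) \<le> 0"
      using key[OF u(1)] by (simp add: mult_le_0_iff)
    ultimately show "\<exists>y. ((\<lambda>u. f u * exp (- g u)) has_real_derivative y) (at u) \<and> y \<le> 0"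
      by blast
  qed auto
  moreover have "f 0 = D 0"
  proof -
    have "f 0 = (\<Sum>j\<le>N. if j = 0 then D 0 else 0)"
      unfolding f_def by (intro sum.cong) (auto simp: power_0_left)
    thus ?thesis by simp
  qed
  moreover have "g 0 = 0"
    by (simp add: g_def)
  ultimately show ?thesis
    by (simp add: f_def g_def exp_minus field_simps)
qed

lemma harmonic_sum_le: "n \<ge> 1 \<Longrightarrow> (\<Sum>m=1..n. 1 / real m) \<le> 1 + ln (real n)"
proof (induction n rule: nat_induct_at_least)
  case (Suc n)
  have "ln (real n / real (Suc n)) \<le> real n / real (Suc n) - 1"
    using Suc by (intro ln_le_minus_one) auto
  hence "1 / real (Suc n) \<le> ln (real (Suc n)) - ln (real n)"
    using Suc by (simp add: ln_div field_simps)
  thus ?case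
    using Suc by simp
qed auto

text \<open>Since \<open>t m \<le> 1\<close>, \<open>n * D n\<close> is at most the sum of all
  \<open>D j\<close>. The factor \<open>n\<close> then cancels against the exponential of the
  harmonic sum, and only the savings \<open>1 - t m\<close> stay in the exponent.\<close>

theorem log_derivative_recursion_bound:
  fixes D t :: "nat \<Rightarrow> real"
  assumes D: "\<And>n. D n \<ge> 0" and t: "\<And>m. 0 \<le> t m" "\<And>m. t m \<le> 1"
    and rec: "\<And>n. real n * D n \<le> (\<Sum>m=1..n. t m * D (n - m))"
    and n: "n \<ge> 1"
  shows "D n \<le> D 0 * exp (1 - (\<Sum>m=1..n. (1 - t m) / real m))"
proof -
  have "real n * D n \<le> (\<Sum>m=1..n. D (n - m))"
    using rec[of n] sum_mono[of "{1..n}" "\<lambda>m. t m * D (n - m)" "\<lambda>m. D (n - m)"] D t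
    by (simp add: mult_left_le_one_le)
  also have "\<dots> = (\<Sum>j<n. D j)"
    by (rule sum.reindex_bij_witness[of _ "\<lambda>j. n - j" "\<lambda>j. n - j"]) auto
  also have "\<dots> \<le> (\<Sum>j\<le>n. D j)"
    using D by (intro sum_mono2) auto
  also have "\<dots> \<le> D 0 * exp (\<Sum>m=1..n. t m / real m)"
    using D t rec by (intro sum_le_exp_of_log_derivative_recursion) auto
  also have "(\<Sum>m=1..n. t m / real m) = (\<Sum>m=1..n. 1 / real m) - (\<Sum>m=1..n. (1 - t m) / real m)"
    by (simp add: diff_divide_distrib sum_subtractf)
  also have "D 0 * exp ((\<Sum>m=1..n. 1 / real m) - (\<Sum>m=1..n. (1 - t m) / real m))
      \<le> D 0 * exp ((1 + ln (real n)) - (\<Sum>m=1..n. (1 - t m) / real m))"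
    using harmonic_sum_le[OF n] D by (intro mult_left_mono) auto
  also have "\<dots> = real n * (D 0 * exp (1 - (\<Sum>m=1..n. (1 - t m) / real m)))"
  proof -
    have "exp ((1 + ln (real n)) - S) = real n * exp (1 - S)" for S
      using n by (simp add: exp_add exp_diff)
    thus ?thesis by simp
  qed
  finally show ?thesis
    using n by simp
qed

section \<open>Multisets invariant under an injection\<close>

text \<open>The length \<open>m\<close> need not be the exact period of \<open>a\<close>: if
  \<open>a\<close> has period \<open>d\<close> and \<open>d dvd m\<close>, this is the orbit taken
  \<open>m div d\<close> times. Admitting such repetitions makes the count in
  \<open>card_cycles_below\<close> exact.\<close>

definition cycle_mset :: "('b \<Rightarrow> 'b) \<Rightarrow> nat \<Rightarrow> 'b \<Rightarrow> 'b multiset" where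
  "cycle_mset f m a = mset (map (\<lambda>i. (f ^^ i) a) [0..<m])"

definition invariant_msets :: "('b \<Rightarrow> 'b) \<Rightarrow> nat \<Rightarrow> 'b multiset set" where
  "invariant_msets f n = {R. size R = n \<and> image_mset f R = R}"

lemma size_cycle_mset [simp]: "size (cycle_mset f m a) = m"
  by (simp add: cycle_mset_def)

lemma image_cycle_mset:
  assumes "(f ^^ m) a = a"
  shows "image_mset f (cycle_mset f m a) = cycle_mset f m a"
proof (cases m)
  case (Suc l)
  have "image_mset f (cycle_mset f m a) = mset (map (\<lambda>i. (f ^^ i) a) (map Suc [0..<m]))"
    by (simp add: cycle_mset_def comp_def flip: mset_map)
  also have "map Suc [0..<m] = [1..<m] @ [m]"
    by (simp add: map_Suc_upt Suc del: upt_Suc) (simp add: Suc)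
  also have "mset (map (\<lambda>i. (f ^^ i) a) ([1..<m] @ [m])) = mset (map (\<lambda>i. (f ^^ i) a) (0 # [1..<m]))"
    using assms by simp
  also have "0 # [1..<m] = [0..<m]"
    by (simp add: Suc upt_conv_Cons)
  finally show ?thesis
    by (simp add: cycle_mset_def)
qed (simp add: cycle_mset_def)

lemma cycle_mset_add:
  assumes "(f ^^ d) a = a"
  shows "cycle_mset f (d + m) a = cycle_mset f d a + cycle_mset f m a"
proof -
  have "(f ^^ (i + d)) a = (f ^^ i) a" for i
    using assms by (simp add: funpow_add)
  hence "map (\<lambda>i. (f ^^ i) a) [d..<m + d] = map (\<lambda>i. (f ^^ i) a) [0..<m]"
    by (simp add: comp_def flip: map_add_upt)
  thus ?thesis
    using upt_add_eq_append[of 0 d m] by (simp add: cycle_mset_def add.commute)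
qed

lemma cycle_mset_mult:
  assumes "(f ^^ d) a = a"
  shows "cycle_mset f (j * d) a = repeat_mset j (cycle_mset f d a)"
  by (induction j) (simp_all add: cycle_mset_add[OF assms], simp add: cycle_mset_def)

lemma funpow_fixed_mult: "(f ^^ d) a = a \<Longrightarrow> (f ^^ (j * d)) a = a"
  by (induction j) (simp_all add: funpow_add)

lemma count_invariant:
  assumes "inj f" "image_mset f R = R"
  shows "count R (f a) = count R a"
proof -
  have "count (image_mset f R) (f a) = count R a"
    using assms(1) by (simp add: count_image_mset vimage_def inj_eq Int_def Collect_conv_if not_in_iff)
  thus ?thesis
    by (simp add: assms(2))
qed

text \<open>Let \<open>d\<close> be the exact period of \<open>a\<close>. The admissible lengths are
  multiples \<open>j * d\<close>, whose cycle is \<open>j\<close> copies of the orbit; as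
  \<open>R\<close> has constant multiplicity on the orbit, it fits into \<open>R\<close> exactly for
  \<open>j \<le> count R a\<close>.\<close>

lemma card_cycles_below:
  assumes f: "inj f" and R: "image_mset f R = R"
  shows "card {m. 1 \<le> m \<and> (f ^^ m) a = a \<and> cycle_mset f m a \<subseteq># R} = count R a"
proof (cases "a \<in># R")
  case False
  have "a \<in># cycle_mset f m a" if "1 \<le> m" for m
    using that by (auto simp: cycle_mset_def intro!: image_eqI[of _ _ 0])
  hence "{m. 1 \<le> m \<and> (f ^^ m) a = a \<and> cycle_mset f m a \<subseteq># R} = {}"
    using False by (auto dest: mset_subset_eqD)
  thus ?thesis
    using False by (metis card.empty not_in_iff)
next
  case True
  have cnt: "count R ((f ^^ i) a) = count R a" for i
    by (induction i) (simp_all add: count_invariant[OF f R])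
  have inR: "(f ^^ i) a \<in># R" for i
    using True cnt[of i] by (metis count_eq_zero_iff)
  \<comment> \<open>The orbit stays inside the finite support of \<open>R\<close>, so two iterates
    coincide, and injectivity of \<open>f\<close> makes \<open>a\<close> itself periodic.\<close>
  have "\<not> inj_on (\<lambda>i. (f ^^ i) a) UNIV"
    using inR finite_subset[of "range (\<lambda>i. (f ^^ i) a)" "set_mset R"] finite_image_iff
    by (metis finite_set_mset image_subsetI infinite_UNIV_nat)
  then obtain i j where ij: "i < j" "(f ^^ i) a = (f ^^ j) a"
    unfolding inj_on_def by (metis linorder_neq_iff)
  have cancel: "(f ^^ (j - i)) a = a" if "i < j" "(f ^^ i) a = (f ^^ j) a" for i j
  proof -
    have "(f ^^ i) ((f ^^ (j - i)) a) = (f ^^ i) a"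
      using that by (simp flip: funpow_add[unfolded o_def, THEN fun_cong])
    thus ?thesis
      using inj_fn[OF f, of i] by (simp add: inj_eq)
  qed
  define d where "d = (LEAST m. 0 < m \<and> (f ^^ m) a = a)"
  have "0 < d \<and> (f ^^ d) a = a"
    unfolding d_def by (rule LeastI[of _ "j - i"]) (use ij cancel in auto)
  hence d: "0 < d" "(f ^^ d) a = a"
    by auto
  have d_min: "d \<le> m" if "0 < m" "(f ^^ m) a = a" for m
    unfolding d_def using that by (intro Least_le) auto
  have d_dvd: "d dvd m" if "(f ^^ m) a = a" for m
  proof -
    have "(f ^^ (m mod d + m div d * d)) a = a"
      using that by (simp add: mod_div_mult_eq)
    hence "(f ^^ (m mod d)) a = a"
      using funpow_fixed_mult[OF d(2), of "m div d"] by (simp only: funpow_add o_apply)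
    thus ?thesis
      using d_min[of "m mod d"] d(1) by (metis dvd_eq_mod_eq_0 mod_less_divisor not_gr_zero not_le)
  qed
  define Orb where "Orb = (\<lambda>i. (f ^^ i) a) ` {..<d}"
  have "inj_on (\<lambda>i. (f ^^ i) a) {..<d}"
  proof (rule linorder_inj_onI')
    fix i j assume "i \<in> {..<d}" "j \<in> {..<d}" "i < j"
    thus "(f ^^ i) a \<noteq> (f ^^ j) a"
      using cancel[of i j] d_min[of "j - i"] by auto
  qed
  hence cyc: "cycle_mset f d a = mset_set Orb"
    by (simp add: cycle_mset_def Orb_def image_mset_mset_set atLeast0LessThan flip: mset_set_upto_eq_mset_upto)
  have below: "cycle_mset f (j * d) a \<subseteq># R \<longleftrightarrow> j \<le> count R a" for j
  proof -
    have "cycle_mset f (j * d) a \<subseteq># R \<longleftrightarrow> (\<forall>x. j * count (mset_set Orb) x \<le> count R x)"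
      by (simp add: cycle_mset_mult[OF d(2)] cyc subseteq_mset_def)
    also have "\<dots> \<longleftrightarrow> (\<forall>x\<in>Orb. j \<le> count R x)"
      by (auto simp: Orb_def count_mset_set')
    also have "\<dots> \<longleftrightarrow> j \<le> count R a"
      using d(1) by (auto simp: Orb_def cnt)
    finally show ?thesis .
  qed
  have "{m. 1 \<le> m \<and> (f ^^ m) a = a \<and> cycle_mset f m a \<subseteq># R} = (\<lambda>j. j * d) ` {1..count R a}"
  proof (intro equalityI subsetI)
    fix m assume m: "m \<in> {m. 1 \<le> m \<and> (f ^^ m) a = a \<and> cycle_mset f m a \<subseteq># R}"
    hence "d dvd m"
      using d_dvd by auto
    then obtain j where "m = j * d"
      by (metis dvd_def mult.commute)
    thus "m \<in> (\<lambda>j. j * d) ` {1..count R a}"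
      using m below by auto
  next
    fix m assume "m \<in> (\<lambda>j. j * d) ` {1..count R a}"
    thus "m \<in> {m. 1 \<le> m \<and> (f ^^ m) a = a \<and> cycle_mset f m a \<subseteq># R}"
      using d below funpow_fixed_mult[OF d(2)] by (auto simp: Suc_le_eq)
  qed
  moreover have "inj_on (\<lambda>j. j * d) {1..count R a}"
    using d(1) by (auto simp: inj_on_def)
  ultimately show ?thesis
    by (simp add: card_image)
qed

text \<open>Double counting of the pairs \<open>(m, a)\<close>: for fixed \<open>a\<close> there are
  \<open>count R a\<close> of them, and the multiplicities add up to the size of
  \<open>R\<close>.\<close>

lemma card_cycles_below_total:
  assumes f: "inj f" and R: "R \<in> invariant_msets f n"
    and fin: "\<And>m. 1 \<le> m \<Longrightarrow> finite {a. (f ^^ m) a = a}"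
  shows "(\<Sum>m=1..n. \<Sum>a | (f ^^ m) a = a. of_bool (cycle_mset f m a \<subseteq># R)) = n"
proof -
  have inv: "image_mset f R = R" and sz: "size R = n"
    using R by (auto simp: invariant_msets_def)
  define B where "B = (SIGMA m:{1..n}. {a. (f ^^ m) a = a \<and> cycle_mset f m a \<subseteq># R})"
  define A where "A = (SIGMA a:set_mset R. {m. 1 \<le> m \<and> (f ^^ m) a = a \<and> cycle_mset f m a \<subseteq># R})"
  have in_cycle: "a \<in># cycle_mset f m a" if "1 \<le> m" for m a
    using that by (auto simp: cycle_mset_def intro!: image_eqI[of _ _ 0])
  have "(\<Sum>m=1..n. \<Sum>a | (f ^^ m) a = a. of_bool (cycle_mset f m a \<subseteq># R))
      = (\<Sum>m=1..n. card {a. (f ^^ m) a = a \<and> cycle_mset f m a \<subseteq># R})"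
    using fin by (intro sum.cong refl) (auto simp: sum.If_cases of_bool_def Collect_conj_eq)
  also have "\<dots> = card B"
    unfolding B_def using fin by (subst card_SigmaI) (auto intro: finite_subset)
  also have "card B = card A"
  proof (rule bij_betw_same_card[of prod.swap])
    have "m \<le> n" if "cycle_mset f m a \<subseteq># R" for m a
      using size_mset_mono[OF that] sz by simp
    moreover have "a \<in># R" if "1 \<le> m" "cycle_mset f m a \<subseteq># R" for m a
      using mset_subset_eqD[OF that(2) in_cycle[OF that(1)]] .
    ultimately show "bij_betw prod.swap B A"
      by (intro bij_betwI[of _ _ _ prod.swap]) (auto simp: A_def B_def)
  qed
  also have "card A = (\<Sum>a\<in>set_mset R. count R a)"
  proof -
    have "finite {m. 1 \<le> m \<and> (f ^^ m) a = a \<and> cycle_mset f m a \<subseteq># R}" for a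
      by (rule finite_subset[of _ "{..size R}"]) (auto dest: size_mset_mono)
    thus ?thesis
      unfolding A_def by (simp add: card_SigmaI card_cycles_below[OF f inv] del: One_nat_def)
  qed
  also have "\<dots> = n"
    using sz by (simp add: size_multiset_overloaded_eq)
  finally show ?thesis .
qed

text \<open>Every element of \<open>R\<close> has a cycle that fits into \<open>R\<close>, hence is
  fixed by some \<open>f ^^ m\<close> with \<open>1 \<le> m \<le> n\<close>.\<close>

lemma finite_invariant_msets:
  assumes f: "inj f" and fin: "\<And>m. 1 \<le> m \<Longrightarrow> finite {a. (f ^^ m) a = a}"
  shows "finite (invariant_msets f n)"
proof (rule finite_subset)
  show "invariant_msets f n \<subseteq> multisets_of_size (\<Union>m\<in>{1..n}. {a. (f ^^ m) a = a}) n"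
  proof
    fix R assume R: "R \<in> invariant_msets f n"
    have "\<exists>m\<in>{1..n}. (f ^^ m) a = a" if "a \<in># R" for a
    proof -
      have "card {m. 1 \<le> m \<and> (f ^^ m) a = a \<and> cycle_mset f m a \<subseteq># R} = count R a"
        using R by (intro card_cycles_below[OF f]) (auto simp: invariant_msets_def)
      hence "{m. 1 \<le> m \<and> (f ^^ m) a = a \<and> cycle_mset f m a \<subseteq># R} \<noteq> {}"
        using that by (metis card.empty count_eq_zero_iff)
      then obtain m where "1 \<le> m" "(f ^^ m) a = a" "cycle_mset f m a \<subseteq># R"
        by auto
      thus ?thesis
        using R size_mset_mono[of "cycle_mset f m a" R] by (auto simp: invariant_msets_def)
    qed
    thus "R \<in> multisets_of_size (\<Union>m\<in>{1..n}. {a. (f ^^ m) a = a}) n"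
      using R by (auto simp: multisets_of_size_def invariant_msets_def)
  qed
  show "finite (multisets_of_size (\<Union>m\<in>{1..n}. {a. (f ^^ m) a = a}) n)"
    using fin by (intro finite_multisets_of_size) auto
qed

text \<open>Write the factor \<open>n\<close> as the number of cycles contained in \<open>R\<close>
  and exchange the sums. Removing a fixed cycle is a bijection from the invariant multisets that
  contain it to those of size \<open>n - m\<close>.\<close>

theorem sum_invariant_msets_rec:
  fixes F :: "'b multiset \<Rightarrow> real"
  assumes f: "inj f" and fin: "\<And>m. 1 \<le> m \<Longrightarrow> finite {a. (f ^^ m) a = a}"
  shows "real n * (\<Sum>R\<in>invariant_msets f n. F R) =
    (\<Sum>m=1..n. \<Sum>a | (f ^^ m) a = a. \<Sum>S\<in>invariant_msets f (n - m). F (S + cycle_mset f m a))"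
proof -
  have "real n * (\<Sum>R\<in>invariant_msets f n. F R) =
    (\<Sum>R\<in>invariant_msets f n. real (\<Sum>m=1..n. \<Sum>a | (f ^^ m) a = a. of_bool (cycle_mset f m a \<subseteq># R)) * F R)"
    using card_cycles_below_total[OF f _ fin] by (simp add: sum_distrib_left)
  also have "\<dots> = (\<Sum>R\<in>invariant_msets f n. \<Sum>m=1..n. \<Sum>a | (f ^^ m) a = a.
      of_bool (cycle_mset f m a \<subseteq># R) * F R)"
    by (simp add: sum_distrib_right)
  also have "\<dots> = (\<Sum>m=1..n. \<Sum>a | (f ^^ m) a = a. \<Sum>R\<in>invariant_msets f n.
      of_bool (cycle_mset f m a \<subseteq># R) * F R)"
    by (subst sum.swap, intro sum.cong refl, subst sum.swap) simp
  also have "\<dots> = (\<Sum>m=1..n. \<Sum>a | (f ^^ m) a = a. \<Sum>S\<in>invariant_msets f (n - m). F (S + cycle_mset f m a))"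
  proof (rule sum.cong[OF refl], rule sum.cong[OF refl])
    fix m a assume m: "m \<in> {1..n}" and "a \<in> {a. (f ^^ m) a = a}"
    hence img: "image_mset f (cycle_mset f m a) = cycle_mset f m a"
      by (simp add: image_cycle_mset)
    have "(\<Sum>R\<in>invariant_msets f n. of_bool (cycle_mset f m a \<subseteq># R) * F R) =
      (\<Sum>R | R \<in> invariant_msets f n \<and> cycle_mset f m a \<subseteq># R. F R)"
      by (simp add: sum.inter_filter[OF finite_invariant_msets[OF f fin]] of_bool_def if_distrib cong: if_cong)
         (intro sum.cong refl, simp)
    also have "\<dots> = (\<Sum>S\<in>invariant_msets f (n - m). F (S + cycle_mset f m a))"
      by (rule sum.reindex_bij_witness[of _ "\<lambda>S. S + cycle_mset f m a" "\<lambda>R. R - cycle_mset f m a"])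
         (use m in \<open>auto simp: invariant_msets_def size_Diff_submset image_mset_Diff img\<close>)
    finally show "(\<Sum>R\<in>invariant_msets f n. of_bool (cycle_mset f m a \<subseteq># R) * F R) =
      (\<Sum>S\<in>invariant_msets f (n - m). F (S + cycle_mset f m a))" .
  qed
  finally show ?thesis .
qed

section \<open>Finite fields and Frobenius\<close>

lemma prime_CHAR_finite_field: "prime CHAR('a::{field,finite})"
  by (intro prime_CHAR_semidom finite_imp_CHAR_pos) simp

section \<open>The order of a finite field is a power of its characteristic\<close>

definition subtraction_closed :: "'a::ab_group_add set \<Rightarrow> bool" where
  "subtraction_closed G \<longleftrightarrow> 0 \<in> G \<and> (\<forall>x\<in>G. \<forall>y\<in>G. x - y \<in> G)"

lemma subtraction_closed_add:
  assumes "subtraction_closed G" "x \<in> G" "y \<in> G"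
  shows "x + y \<in> G"
proof -
  have "x - (0 - y) \<in> G"
    using assms by (auto simp: subtraction_closed_def simp del: diff_0)
  thus ?thesis by simp
qed

lemma subtraction_closed_of_nat_mult:
  fixes x :: "'a::comm_ring_1"
  assumes "subtraction_closed G" "x \<in> G"
  shows "of_nat n * x \<in> G"
proof (induction n)
  case 0
  thus ?case using assms by (simp add: subtraction_closed_def)
next
  case (Suc n)
  thus ?case using subtraction_closed_add[OF assms Suc] by (simp add: algebra_simps)
qed

text \<open>If \<open>d * x\<close> were in \<open>G\<close> with \<open>0 < d < p\<close>, an
  inverse of \<open>d\<close> modulo \<open>p\<close> would bring \<open>x\<close> into
  \<open>G\<close>. So the translates of \<open>G\<close> by the first \<open>p\<close> multiples of
  \<open>x\<close> are disjoint, and their union is again a subgroup.\<close>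

lemma subtraction_closed_extend:
  fixes G :: "'a::{field,finite} set"
  assumes G: "subtraction_closed G" and x: "x \<notin> G"
  shows "\<exists>G'::'a set. subtraction_closed G' \<and> card G' = CHAR('a) * card G"
proof -
  define p where "p = CHAR('a)"
  have p: "prime p"
    unfolding p_def by (rule prime_CHAR_finite_field)
  have p0: "of_nat p = (0::'a)"
    by (simp add: p_def)
  define h where "h = (\<lambda>(g::'a, i::nat). g + of_nat i * x)"
  have multiple: "\<not> of_nat d * x \<in> G" if d: "0 < d" "d < p" for d
  proof
    assume dx: "of_nat d * x \<in> G"
    have "coprime d p"
      using d p by (metis coprime_commute nat_dvd_not_less prime_imp_coprime)
    then obtain c where "[d * c = 1] (mod p)"
      using cong_solve_coprime_nat by auto
    hence "of_nat (d * c) = (of_nat 1 :: 'a)"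
      by (subst of_nat_eq_iff_cong_CHAR) (simp add: p_def)
    hence "of_nat c * (of_nat d * x) = x"
      by (metis mult.assoc mult.commute mult_1 of_nat_1 of_nat_mult)
    with subtraction_closed_of_nat_mult[OF G dx, of c] have "x \<in> G"
      by (simp only:)
    thus False
      using x by contradiction
  qed
  have "i = j" if "g \<in> G" "g' \<in> G" "i < p" "j < p" "g + of_nat i * x = g' + of_nat j * x" "i \<le> j" for g g' i j
  proof (rule ccontr)
    assume "i \<noteq> j"
    have "of_nat (j - i) * x = g - g'"
      using that by (simp add: of_nat_diff algebra_simps)
    moreover have "g - g' \<in> G"
      using G that by (auto simp: subtraction_closed_def)
    ultimately have "of_nat (j - i) * x \<in> G"
      by (simp only:)
    thus False
      using multiple[of "j - i"] that(3,4,6) \<open>i \<noteq> j\<close> by (metis diff_is_0_eq le_antisym less_imp_diff_less not_gr_zero)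
  qed
  hence "inj_on h (G \<times> {..<p})"
    unfolding inj_on_def h_def by clarsimp (metis add_right_cancel nle_le)
  hence "card (h ` (G \<times> {..<p})) = p * card G"
    by (simp add: card_image card_cartesian_product)
  moreover have "subtraction_closed (h ` (G \<times> {..<p}))"
    unfolding subtraction_closed_def
  proof (intro conjI ballI)
    show "0 \<in> h ` (G \<times> {..<p})"
      using G p by (auto simp: h_def subtraction_closed_def prime_gt_0_nat intro!: image_eqI[of _ _ "(0, 0)"])
  next
    fix y z assume "y \<in> h ` (G \<times> {..<p})" "z \<in> h ` (G \<times> {..<p})"
    then obtain g i g' j where *: "y = g + of_nat i * x" "z = g' + of_nat j * x" "g \<in> G" "g' \<in> G" "j < p"
      by (auto simp: h_def)
    \<comment> \<open>\<open>i + (p - j)\<close> stands for the possibly negative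
      \<open>i - j\<close>; adding \<open>p\<close> changes nothing in characteristic
      \<open>p\<close>.\<close>
    have "y - z = (g - g') + of_nat (i + (p - j)) * x"
      using * by (simp add: of_nat_diff p0 algebra_simps)
    also have "of_nat (i + (p - j)) = (of_nat ((i + (p - j)) mod p) :: 'a)"
      by (subst of_nat_eq_iff_cong_CHAR) (simp add: p_def cong_def)
    finally have "y - z = h (g - g', (i + (p - j)) mod p)"
      by (simp add: h_def)
    thus "y - z \<in> h ` (G \<times> {..<p})"
      using * G p by (auto simp: subtraction_closed_def prime_gt_0_nat)
  qed
  ultimately show ?thesis
    unfolding p_def by blast
qed

text \<open>A largest subgroup whose order is a power of the characteristic must be everything,
  since otherwise it could be extended. The result is what makes raising to the power
  \<open>CARD('a)\<close> additive on the algebraic closure.\<close>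

theorem CARD_finite_field_eq_CHAR_power: "\<exists>s. CARD('a::{field,finite}) = CHAR('a) ^ s"
proof -
  define P where "P = (\<lambda>s. \<exists>G::'a set. subtraction_closed G \<and> card G = CHAR('a) ^ s)"
  have "P 0"
    unfolding P_def by (intro exI[of _ "{0}"]) (simp add: subtraction_closed_def)
  have bound: "s \<le> CARD('a)" if s: "P s" for s
  proof -
    obtain G :: "'a set" where "card G = CHAR('a) ^ s"
      using s unfolding P_def by blast
    hence "CHAR('a) ^ s \<le> CARD('a)"
      using card_mono[of UNIV G] by simp
    moreover have "s < CHAR('a) ^ s"
      using prime_CHAR_finite_field[where 'a='a] by (intro power_gt_expt) (auto dest: prime_gt_1_nat)
    ultimately show ?thesis by simp
  qed
  define s where "s = Greatest P"
  have s: "P s" "\<And>s'. P s' \<Longrightarrow> s' \<le> s"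
    unfolding s_def using GreatestI_nat[of P, OF \<open>P 0\<close> bound] Greatest_le_nat[of P, OF _ bound] by blast+
  then obtain G :: "'a set" where G: "subtraction_closed G" "card G = CHAR('a) ^ s"
    unfolding P_def by blast
  have "G = UNIV"
  proof (rule ccontr)
    assume "G \<noteq> UNIV"
    then obtain x where "x \<notin> G" by blast
    from subtraction_closed_extend[OF G(1) this] have "P (Suc s)"
      by (simp add: G(2) P_def)
    from s(2)[OF this] show False
      by simp
  qed
  thus ?thesis
    using G(2) by (intro exI[of _ s]) simp
qed

lemma CARD_finite_field_gt_1: "CARD('a::{field,finite}) > 1"
proof -
  have "card {0, 1::'a} \<le> CARD('a)"
    by (rule card_mono) auto
  thus ?thesis by simp
qed

lemma finite_field_power_card: "x ^ CARD('a) = (x::'a::{field,finite})"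
proof (cases "x = 0")
  case True
  thus ?thesis
    using CARD_finite_field_gt_1[where 'a='a] by (simp add: power_0_left)
next
  case False
  have "(\<Prod>y\<in>UNIV-{0}. x * y) = (\<Prod>y\<in>UNIV-{0::'a}. y)"
    by (rule prod.reindex_bij_witness[of _ "\<lambda>y. y / x" "\<lambda>y. x * y"]) (use False in auto)
  hence "x ^ (CARD('a) - 1) * (\<Prod>y\<in>UNIV-{0::'a}. y) = (\<Prod>y\<in>UNIV-{0::'a}. y)"
    by (simp add: prod.distrib)
  hence "x ^ (CARD('a) - 1) = 1"
    by simp
  thus ?thesis
    using CARD_finite_field_gt_1[where 'a='a]
    by (metis One_nat_def Suc_pred less_trans mult.right_neutral power_Suc zero_less_one)
qed

lemma coprime_CARD_iff: "coprime n CARD('a::{field,finite}) \<longleftrightarrow> \<not> CHAR('a) dvd n"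
proof -
  obtain s where s: "CARD('a) = CHAR('a) ^ s"
    using CARD_finite_field_eq_CHAR_power by blast
  have "s > 0"
    using s CARD_finite_field_gt_1[where 'a='a] by (cases s) auto
  thus ?thesis
    using prime_CHAR_finite_field[where 'a='a]
    by (auto simp: s coprime_commute[of n] prime_imp_coprime)
qed

lemma frobenius_add: "(x + y :: 'a::{field,finite} alg_closure) ^ (CARD('a) ^ m) = x ^ (CARD('a) ^ m) + y ^ (CARD('a) ^ m)"
proof -
  obtain s where "CARD('a) = CHAR('a alg_closure) ^ s"
    using CARD_finite_field_eq_CHAR_power[where 'a='a] by auto
  thus ?thesis
    using prime_CHAR_finite_field[where 'a='a]
    by (intro freshmans_dream'[of _ "s * m"]) (simp_all add: power_mult)
qed

lemma frobenius_sum: "(sum f A :: 'a::{field,finite} alg_closure) ^ (CARD('a) ^ m) = (\<Sum>i\<in>A. f i ^ (CARD('a) ^ m))"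
  using CARD_finite_field_gt_1[where 'a='a]
  by (induction A rule: infinite_finite_induct) (auto simp: frobenius_add)

lemma frobenius_diff: "(x - y :: 'a::{field,finite} alg_closure) ^ (CARD('a) ^ m) = x ^ (CARD('a) ^ m) - y ^ (CARD('a) ^ m)"
  by (metis add_diff_cancel_right' diff_add_cancel frobenius_add)

lemma to_ac_power_card [simp]: "to_ac (x::'a::{field,finite}) ^ (CARD('a) ^ m) = to_ac x"
proof (induction m)
  case (Suc m)
  have "to_ac x ^ (CARD('a) ^ Suc m) = (to_ac x ^ (CARD('a) ^ m)) ^ CARD('a)"
    by (simp add: power_mult[symmetric] mult.commute)
  also have "\<dots> = to_ac (x ^ CARD('a))"
    by (simp only: Suc to_ac_power)
  finally show ?case
    by (simp only: finite_field_power_card)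
qed simp

lemma inj_frobenius: "inj (\<lambda>x::'a::{field,finite} alg_closure. x ^ CARD('a))"
proof (rule injI)
  fix x y :: "'a alg_closure" assume "x ^ CARD('a) = y ^ CARD('a)"
  hence "(x - y) ^ CARD('a) = 0"
    using frobenius_diff[of x y 1] by simp
  thus "x = y" by simp
qed

lemma funpow_frobenius: "((\<lambda>x::'a::{field,finite} alg_closure. x ^ CARD('a)) ^^ m) x = x ^ (CARD('a) ^ m)"
  by (induction m) (simp_all add: power_mult[symmetric] mult.commute)

lemma proots_prod_linear_factors:
  "proots (\<Prod>x\<in>#A. [:x, 1:]) = image_mset uminus (A :: 'b::idom multiset)"
proof (induction A)
  case (add x A)
  have "(\<Prod>x\<in>#A. [:x, 1:]) \<noteq> 0"
    by (auto simp: prod_mset_zero_iff)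
  hence "proots ([:x, 1:] * (\<Prod>x\<in>#A. [:x, 1:])) = proots [:x, 1:] + proots (\<Prod>x\<in>#A. [:x, 1:])"
    by (intro proots_mult) auto
  thus ?case
    using add by (simp del: mult_pCons_left)
qed simp

text \<open>The polynomial \<open>x ^ (q ^ m) - x\<close> has derivative \<open>-1\<close>, so its
  roots are simple, and over an algebraically closed field there are as many as its degree.\<close>

lemma card_frobenius_fixed:
  assumes "m \<ge> 1"
  shows "finite {x::'a::{field,finite} alg_closure. x ^ (CARD('a) ^ m) = x}" "card {x::'a alg_closure. x ^ (CARD('a) ^ m) = x} = CARD('a) ^ m"
proof -
  define P :: "'a alg_closure poly" where "P = monom 1 (CARD('a) ^ m) - monom 1 1"
  have qm: "CARD('a) ^ m > 1"
    using assms CARD_finite_field_gt_1[where 'a='a] by (intro one_less_power) auto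
  have coeff: "coeff P (CARD('a) ^ m) = 1"
    using qm by (simp add: P_def)
  hence P0: "P \<noteq> 0" by auto
  have degP: "degree P = CARD('a) ^ m"
  proof (rule antisym)
    show "degree P \<le> CARD('a) ^ m"
      unfolding P_def using qm by (intro degree_diff_le) (auto simp: degree_monom_eq)
    show "CARD('a) ^ m \<le> degree P"
      using coeff by (intro le_degree) auto
  qed
  have roots: "{x. poly P x = 0} = {x. x ^ (CARD('a) ^ m) = x}"
    by (auto simp: P_def poly_monom)
  show "finite {x::'a alg_closure. x ^ (CARD('a) ^ m) = x}"
    using poly_roots_finite[OF P0] roots by simp
  have "CHAR('a alg_closure) dvd CARD('a) ^ m"
    using assms CHAR_dvd_CARD[where 'a='a] by (simp add: dvd_power_iff dvd_trans[OF _ dvd_power])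
  hence "of_nat (CARD('a) ^ m) = (0 :: 'a alg_closure)"
    using of_nat_eq_0_iff_char_dvd by blast
  hence pd: "pderiv P = -1"
    by (simp add: P_def pderiv_diff pderiv_monom monom_0 one_pCons del: of_nat_power)
  have ord: "order x P = 1" if "poly P x = 0" for x
  proof (rule ccontr)
    assume "order x P \<noteq> 1"
    moreover have "order x P \<noteq> 0"
      using that P0 by (simp add: order_root)
    ultimately have "[:-x, 1:] ^ 2 dvd P"
      by (intro order_divides[THEN iffD2]) auto
    then obtain r where r: "P = [:-x, 1:] ^ 2 * r" by (elim dvdE)
    have "poly (pderiv P) x = 0"
      unfolding r power2_eq_square mult.assoc pderiv_mult by simp
    thus False using pd by simp
  qed
  have "CARD('a) ^ m = size (proots P)"
  proof -
    obtain A where A: "size A = degree P" "P = smult (lead_coeff P) (\<Prod>x\<in>#A. [:-x, 1:])"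
      using alg_closed_imp_factorization[OF P0] by blast
    have "proots P = proots (\<Prod>x\<in>#A. [:-x, 1:])"
      using P0 A(2) by (metis leading_coeff_0_iff proots_smult)
    also have "\<dots> = A"
      using proots_prod_linear_factors[of "image_mset uminus A"] by (simp add: multiset.map_comp comp_def)
    finally show ?thesis using A(1) degP by simp
  qed
  also have "\<dots> = (\<Sum>x | poly P x = 0. count (proots P) x)"
    using P0 by (simp add: size_multiset_overloaded_eq)
  also have "\<dots> = (\<Sum>x | poly P x = 0. 1)"
    using P0 ord by (intro sum.cong) auto
  finally show "card {x::'a alg_closure. x ^ (CARD('a) ^ m) = x} = CARD('a) ^ m"
    by (simp add: roots)
qed

lemma card_base_field: "card (base_field :: 'a::{field,finite} alg_closure set) = CARD('a)"
  by (simp add: base_field_def card_image inj_to_ac)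

text \<open>One inclusion is Fermat's little theorem for the finite field; equality follows because
  both sets have \<open>CARD('a)\<close> elements.\<close>

lemma base_field_iff: "x \<in> base_field \<longleftrightarrow> x ^ CARD('a) = (x :: 'a::{field,finite} alg_closure)"
proof -
  have "base_field \<subseteq> {x::'a alg_closure. x ^ CARD('a) = x}"
    using to_ac_power_card[of _ 1] by (auto simp: base_field_def)
  moreover have "finite {x::'a alg_closure. x ^ CARD('a) = x}" "card {x::'a alg_closure. x ^ CARD('a) = x} = CARD('a)"
    using card_frobenius_fixed[of 1, where 'a='a] by simp_all
  ultimately have "base_field = {x::'a alg_closure. x ^ CARD('a) = x}"
    by (intro card_subset_eq) (simp_all add: card_base_field)
  thus ?thesis by blast
qed

text \<open>Each element is a root of one of countably many polynomials. Countability is what later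
  makes sums of random variables with values in this discrete space measurable.\<close>

lemma countable_alg_closure: "countable (UNIV :: 'a::{field,finite} alg_closure set)"
proof -
  have "inj (coeffs :: 'a poly \<Rightarrow> 'a list)"
    by (simp add: inj_def coeffs_eq_iff)
  hence "countable (UNIV :: 'a poly set)"
    by (rule countableI')
  hence "countable (\<Union>p\<in>UNIV - {0::'a poly}. {x. poly (map_poly to_ac p) x = 0})"
    by (intro countable_UN countable_Diff countable_finite[OF poly_roots_finite]) 
       (simp_all add: map_poly_eq_0_iff)
  moreover have "UNIV = (\<Union>p\<in>UNIV - {0::'a poly}. {x. poly (map_poly to_ac p) x = 0})"
  proof (rule UNIV_eq_I)
    fix x show "x \<in> (\<Union>p\<in>UNIV - {0::'a poly}. {x. poly (map_poly to_ac p) x = 0})"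
      by (rule alg_closure_algebraic[of x]) auto
  qed
  ultimately show ?thesis by simp
qed

section \<open>Stepanov's method\<close>

definition ac_eval :: "'a::field poly \<Rightarrow> 'a alg_closure \<Rightarrow> 'a alg_closure" where
  "ac_eval p x = poly (map_poly to_ac p) x"

lemma ac_eval_0 [simp]: "ac_eval 0 x = 0"
  by (simp add: ac_eval_def)

lemma ac_eval_pCons [simp]: "ac_eval (pCons a p) x = to_ac a + x * ac_eval p x"
  by (simp add: ac_eval_def map_poly_pCons)

lemma ac_eval_1 [simp]: "ac_eval 1 x = 1"
  by (simp add: one_pCons)

lemma ac_eval_add [simp]: "ac_eval (p + r) x = ac_eval p x + ac_eval r x"
  by (induction p r rule: poly_induct2) (auto simp: algebra_simps)

lemma ac_eval_diff [simp]: "ac_eval (p - r) x = ac_eval p x - ac_eval r x"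
  using ac_eval_add[of "p - r" r x] by (simp del: ac_eval_add)

lemma ac_eval_smult [simp]: "ac_eval (smult a p) x = to_ac a * ac_eval p x"
  by (induction p) (auto simp: algebra_simps)

lemma ac_eval_mult [simp]: "ac_eval (p * r) x = ac_eval p x * ac_eval r x"
  by (induction p) (auto simp: algebra_simps)

lemma ac_eval_power [simp]: "ac_eval (p ^ n) x = ac_eval p x ^ n"
  by (induction n) auto

lemma ac_eval_sum: "ac_eval (sum f A) x = (\<Sum>i\<in>A. ac_eval (f i) x)"
  by (induction A rule: infinite_finite_induct) auto

lemma ac_eval_monom [simp]: "ac_eval (monom a n) x = to_ac a * x ^ n"
  by (induction n) (auto simp: monom_0 monom_Suc)

lemma ac_eval_frobenius:
  fixes p :: "'a::{field,finite} poly"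
  shows "ac_eval p x ^ (CARD('a) ^ m) = ac_eval p (x ^ (CARD('a) ^ m))"
proof (induction p)
  case 0
  thus ?case using CARD_finite_field_gt_1[where 'a='a] by simp
next
  case (pCons a p)
  thus ?case by (simp add: frobenius_add power_mult_distrib)
qed

lemma card_ac_eval_roots_le:
  assumes "p \<noteq> 0"
  shows "finite {x. ac_eval p x = 0}" "card {x. ac_eval p x = 0} \<le> degree p"
proof -
  have "map_poly to_ac p \<noteq> 0"
    using assms by (simp add: map_poly_eq_0_iff)
  thus "finite {x. ac_eval p x = 0}" "card {x. ac_eval p x = 0} \<le> degree p"
    unfolding ac_eval_def
    using card_poly_roots_bound[of "map_poly to_ac p"] degree_map_poly[of to_ac p]
    by (auto intro: poly_roots_finite)
qed

text \<open>At a point of the field of size \<open>q ^ m\<close> its value is the trace of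
  \<open>h(x)\<close> down to the base field. It is kept as a polynomial because Stepanov's method
  uses it for smaller \<open>m\<close> too, where only its degree matters.\<close>

definition trace_poly :: "nat \<Rightarrow> 'a::{field,finite} poly \<Rightarrow> 'a poly" where
  "trace_poly m h = (\<Sum>i<m. h ^ (CARD('a) ^ i))"

lemma ac_eval_trace_poly:
  fixes h :: "'a::{field,finite} poly"
  shows "ac_eval (trace_poly m h) x = (\<Sum>i<m. ac_eval h x ^ (CARD('a) ^ i))"
  by (simp add: trace_poly_def ac_eval_sum)

text \<open>This cocycle identity has two uses: it shows that traces lie in the base field, and it
  splits the trace into the two pieces between which Stepanov's method moves.\<close>

lemma ac_eval_trace_poly_add:
  fixes h :: "'a::{field,finite} poly"
  shows "ac_eval (trace_poly (m + n) h) x =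
    ac_eval (trace_poly m h) x + ac_eval (trace_poly n h) x ^ (CARD('a) ^ m)"
proof -
  have "(\<Sum>i<m + n. ac_eval h x ^ (CARD('a) ^ i)) =
    (\<Sum>i<m. ac_eval h x ^ (CARD('a) ^ i)) + (\<Sum>i<n. ac_eval h x ^ (CARD('a) ^ (i + m)))"
    by (induction n) (simp_all add: add_ac)
  thus ?thesis
    by (simp only: ac_eval_trace_poly frobenius_sum power_add power_mult)
qed

lemma degree_trace_poly:
  fixes h :: "'a::{field,finite} poly"
  assumes "degree h > 0"
  shows "degree (trace_poly (Suc m) h) = degree h * CARD('a) ^ m"
proof (induction m)
  case 0
  thus ?case by (simp add: trace_poly_def)
next
  case (Suc m)
  have "degree (h ^ (CARD('a) ^ Suc m)) = degree h * CARD('a) ^ Suc m"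
    using assms by (subst degree_power_eq) auto
  moreover have "degree h * CARD('a) ^ m < degree h * CARD('a) ^ Suc m"
    using assms CARD_finite_field_gt_1[where 'a='a] by simp
  moreover have "trace_poly (Suc (Suc m)) h = trace_poly (Suc m) h + h ^ (CARD('a) ^ Suc m)"
    by (simp add: trace_poly_def)
  ultimately show ?case
    using Suc by (simp only: degree_add_eq_right)
qed

text \<open>Expand the trace polynomial of length \<open>m + 1\<close> in both orders. At a point
  fixed by the \<open>m\<close>-th power of Frobenius the pieces of length 1 cancel, leaving that
  the trace equals its own \<open>CARD('a)\<close>-th power.\<close>

lemma trace_poly_fixed_in_base_field:
  fixes h :: "'a::{field,finite} poly"
  assumes "x ^ (CARD('a) ^ m) = x"
  shows "ac_eval (trace_poly m h) x \<in> base_field"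
proof -
  have "ac_eval (trace_poly (m + 1) h) x = ac_eval (trace_poly (1 + m) h) x"
    by (simp only: add.commute)
  moreover have "ac_eval (trace_poly 1 h) x ^ (CARD('a) ^ m) = ac_eval (trace_poly 1 h) x"
    by (simp only: ac_eval_frobenius assms)
  ultimately show ?thesis
    unfolding ac_eval_trace_poly_add base_field_iff by simp
qed

text \<open>Among the terms with nonzero coefficient, the leading term of the one of largest degree
  cannot be cancelled.\<close>

lemma linear_combination_distinct_degrees_nonzero:
  fixes p :: "'i \<Rightarrow> 'b::idom poly"
  assumes A: "finite A" and inj: "inj_on (\<lambda>a. degree (p a)) A"
    and p: "\<And>a. a \<in> A \<Longrightarrow> p a \<noteq> 0" and a0: "a0 \<in> A" "c a0 \<noteq> 0"
  shows "(\<Sum>a\<in>A. smult (c a) (p a)) \<noteq> 0"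
proof -
  define B where "B = {a\<in>A. c a \<noteq> 0}"
  have "finite B" "B \<noteq> {}"
    using A a0 by (auto simp: B_def)
  hence "Max ((\<lambda>a. degree (p a)) ` B) \<in> (\<lambda>a. degree (p a)) ` B"
    by (intro Max_in) auto
  then obtain a where a: "a \<in> B" "degree (p a) = Max ((\<lambda>a. degree (p a)) ` B)"
    by auto
  have a_max: "degree (p a') \<le> degree (p a)" if "a' \<in> B" for a'
    using that \<open>finite B\<close> by (simp add: a(2))
  have "coeff (\<Sum>a\<in>A. smult (c a) (p a)) (degree (p a)) = (\<Sum>a'\<in>A. c a' * coeff (p a') (degree (p a)))"
    by (simp add: coeff_sum)
  also have "\<dots> = (\<Sum>a'\<in>{a}. c a' * coeff (p a') (degree (p a)))"
  proof (rule sum.mono_neutral_right)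
    show "\<forall>a'\<in>A - {a}. c a' * coeff (p a') (degree (p a)) = 0"
    proof
      fix a' assume a': "a' \<in> A - {a}"
      show "c a' * coeff (p a') (degree (p a)) = 0"
      proof (cases "c a' = 0")
        case False
        hence "degree (p a') \<le> degree (p a)"
          using a' a_max by (auto simp: B_def)
        moreover have "degree (p a') \<noteq> degree (p a)"
          using inj a' a(1) by (auto simp: B_def inj_on_def)
        ultimately show ?thesis
          by (simp add: coeff_eq_0)
      qed simp
    qed
  qed (use A a in \<open>auto simp: B_def\<close>)
  also have "\<dots> \<noteq> 0"
    using a(1) p by (auto simp: B_def)
  finally show ?thesis
    by auto
qed

text \<open>Linear dependence by the pigeonhole principle: there are \<open>q ^ card J\<close>
  coefficient vectors but only \<open>q ^ D\<close> polynomials of degree below \<open>D\<close>, so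
  two vectors give the same combination, and their difference is the relation.\<close>

lemma exists_nontrivial_relation:
  fixes A :: "'i \<Rightarrow> 'a::{field,finite} poly"
  assumes J: "finite J" and deg: "\<And>j. j \<in> J \<Longrightarrow> degree (A j) < D" and card: "D < card J"
  shows "\<exists>d j0. j0 \<in> J \<and> d j0 \<noteq> 0 \<and> (\<Sum>j\<in>J. smult (d j) (A j)) = 0"
proof -
  define \<Psi> where "\<Psi> = (\<lambda>c. \<Sum>j\<in>J. smult (c j) (A j))"
  define F where "F = (\<lambda>c. \<lambda>n\<in>{..<D}. coeff (\<Psi> c) n)"
  have "\<not> inj_on F (J \<rightarrow>\<^sub>E UNIV)"
  proof
    assume "inj_on F (J \<rightarrow>\<^sub>E UNIV)"
    moreover have "F ` (J \<rightarrow>\<^sub>E UNIV) \<subseteq> {..<D} \<rightarrow>\<^sub>E UNIV"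
      by (auto simp: F_def intro!: restrict_PiE_iff[THEN iffD2] simp del: restrict_apply)
    ultimately have "card (J \<rightarrow>\<^sub>E (UNIV::'a set)) \<le> card ({..<D} \<rightarrow>\<^sub>E (UNIV::'a set))"
      by (intro card_inj_on_le[of F]) (auto intro: finite_PiE)
    hence "CARD('a) ^ card J \<le> CARD('a) ^ D"
      using J by (simp add: card_PiE)
    thus False
      using card CARD_finite_field_gt_1[where 'a='a] by (simp add: power_increasing_iff)
  qed
  then obtain c c' where c: "c \<in> J \<rightarrow>\<^sub>E UNIV" "c' \<in> J \<rightarrow>\<^sub>E UNIV" "c \<noteq> c'" "F c = F c'"
    by (auto simp: inj_on_def)
  obtain j0 where j0: "j0 \<in> J" "c j0 \<noteq> c' j0"
    using PiE_ext[OF c(1,2)] c(3) by blast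
  have "coeff (\<Psi> c) n = coeff (\<Psi> c') n" for n
  proof (cases "n < D")
    case True
    thus ?thesis
      using fun_cong[OF c(4), of n] by (simp add: F_def)
  next
    case False
    hence "coeff (A j) n = 0" if "j \<in> J" for j
      using deg[OF that] by (intro coeff_eq_0) auto
    thus ?thesis
      by (simp add: \<Psi>_def coeff_sum)
  qed
  hence "\<Psi> c - \<Psi> c' = 0"
    by (simp add: poly_eq_iff)
  hence "(\<Sum>j\<in>J. smult (c j - c' j) (A j)) = 0"
    by (simp add: \<Psi>_def smult_diff_left sum_subtractf)
  thus ?thesis
    using j0 by (intro exI[of _ "\<lambda>j. c j - c' j"] exI[of _ j0]) auto
qed

text \<open>Stepanov's method. On the set in question, Frobenius turns the auxiliary polynomial
  \<open>\<Sum> d\<^sub>i\<^sub>j\<^sub>l x\<^sup>l (x ^ q ^ \<nu>)\<^sup>i T\<^sub>\<nu>\<^sup>j\<close> into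
  \<open>\<Sum> d\<^sub>i\<^sub>j\<^sub>l (x ^ q ^ \<mu>)\<^sup>l x\<^sup>i (b - T\<^sub>\<mu>)\<^sup>j\<close>, where \<open>T\<^sub>m = h + h ^ q + \<dots> + h ^ q ^ (m - 1)\<close>.
  The second one has so small a degree that it vanishes identically for suitable coefficients in
  the base field, while the terms of the first one have distinct degrees.\<close>

theorem card_trace_fibre_le:
  fixes h :: "'a::{field,finite} poly" and b :: 'a
  assumes k: "degree h = k" "k \<ge> 1" "coprime k CARD('a)" and \<mu>: "\<mu> \<ge> 1" "\<mu> \<le> \<nu>"
  shows "card {x. x ^ (CARD('a) ^ (\<mu> + \<nu>)) = x \<and> ac_eval (trace_poly (\<mu> + \<nu>) h) x = to_ac b}
    \<le> CARD('a) ^ (\<mu> + \<nu> - 1) + (2 * k + 2) * CARD('a) ^ \<nu>" (is "card ?X \<le> _")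
proof -
  define q where "q = CARD('a)"
  have q: "q > 1"
    using CARD_finite_field_gt_1[where 'a='a] by (simp add: q_def)
  obtain \<mu>' \<nu>' where Suc: "\<mu> = Suc \<mu>'" "\<nu> = Suc \<nu>'"
    using \<mu> by (cases \<mu>; cases \<nu>) auto
  show ?thesis
  \<comment> \<open>If this fails, the claimed bound is at least the number
    \<open>q ^ (\<mu> + \<nu>)\<close> of all points of the field. If it holds, it provides the room
    needed for \<open>D < card J\<close>.\<close>
  proof (cases "k + 2 \<le> 2 * q ^ \<nu>")
    case False
    have "card ?X \<le> card {x::'a alg_closure. x ^ (q ^ (\<mu> + \<nu>)) = x}"
      using \<mu> card_frobenius_fixed(1)[of "\<mu> + \<nu>", where 'a='a] unfolding q_def by (intro card_mono) auto
    also have "\<dots> = q ^ \<mu> * q ^ \<nu>"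
      using \<mu> card_frobenius_fixed(2)[of "\<mu> + \<nu>", where 'a='a] by (simp add: q_def power_add)
    also have "\<dots> \<le> q ^ \<nu> * q ^ \<nu>"
      using \<mu> q by (intro mult_right_mono power_increasing) auto
    also have "\<dots> \<le> (2 * k + 2) * q ^ \<nu>"
      using False by (intro mult_right_mono) auto
    finally show ?thesis
      by (simp add: q_def)
  next
    case True
    \<comment> \<open>\<open>k * L\<close> is the degree of \<open>T\<nu>\<close>, so
      \<open>l < L\<close> can be read off from the degrees below. \<open>I\<close> makes
      \<open>card J = L * q ^ \<mu> + k * q ^ \<nu> + 2 * q ^ \<nu>\<close>: the first summand pays
      for the exponents \<open>l * q ^ \<mu>\<close> in \<open>A\<close>, the second for the powers
      of \<open>[:b:] - T\<mu>\<close>, the third for the remaining \<open>k + 2\<close>.\<close>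
    define L where "L = q ^ \<nu>'"
    define I where "I = q ^ \<mu>' + k + 2"
    define J where "J = {..<I} \<times> {..<q} \<times> {..<L}"
    define T\<mu> where "T\<mu> = trace_poly \<mu> h"
    define T\<nu> where "T\<nu> = trace_poly \<nu> h"
    have L: "L \<ge> 1" "q ^ \<nu> = q * L" "q ^ \<mu> = q * q ^ \<mu>'" "q ^ \<mu>' \<ge> 1"
      using q by (simp_all add: L_def Suc)
    have deg_T\<mu>: "degree T\<mu> = k * q ^ \<mu>'" and deg_T\<nu>: "degree T\<nu> = k * L"
      using k degree_trace_poly[of h] by (simp_all add: T\<mu>_def T\<nu>_def Suc q_def L_def)
    define A where "A = (\<lambda>(i,j,l). monom 1 (l * q ^ \<mu> + i) * ([:b:] - T\<mu>) ^ j)"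
    define D where "D = (L - 1) * q ^ \<mu> + (I - 1) + (q - 1) * (k * q ^ \<mu>') + 1"
    have degA: "degree (A t) < D" if tJ: "t \<in> J" for t
    proof -
      obtain i j l where t: "t = (i, j, l)" "i < I" "j < q" "l < L"
        using tJ by (cases t) (auto simp: J_def)
      have "degree ([:b:] - T\<mu>) \<le> k * q ^ \<mu>'"
        by (intro degree_diff_le) (simp_all add: deg_T\<mu>)
      hence "degree (([:b:] - T\<mu>) ^ j) \<le> (q - 1) * (k * q ^ \<mu>')"
        using degree_power_le[of "[:b:] - T\<mu>" j] t
        by (elim order.trans) (simp add: mult.commute mult_le_mono)
      moreover have "degree (monom (1::'a) (l * q ^ \<mu> + i)) \<le> (L - 1) * q ^ \<mu> + (I - 1)"
      proof -
        have "l \<le> L - 1" "i \<le> I - 1"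
          using t by auto
        thus ?thesis
          by (simp only: degree_monom_eq[OF one_neq_zero] add_mono mult_le_mono le_refl)
      qed
      ultimately have "degree (monom (1::'a) (l * q ^ \<mu> + i) * ([:b:] - T\<mu>) ^ j)
        \<le> ((L - 1) * q ^ \<mu> + (I - 1)) + (q - 1) * (k * q ^ \<mu>')"
        by (intro order.trans[OF degree_mult_le] add_mono)
      thus ?thesis
        unfolding A_def t D_def prod.case by linarith
    qed
    have "D < card J"
    proof -
      have *: "x + (a' + k + 2 - 1) + y + 1 < la + kn + 2 * n"
        if "x + a = la" "y + ka' = ka" "a' < a" "ka \<le> kn" "k + 2 \<le> 2 * n" for x y a a' la n ka ka' kn :: nat
        using that by linarith
      have "D < L * q ^ \<mu> + k * q ^ \<nu> + 2 * q ^ \<nu>"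
        unfolding D_def I_def
      proof (rule *)
        show "(L - 1) * q ^ \<mu> + q ^ \<mu> = L * q ^ \<mu>"
          using L(1) by (cases L) auto
        show "(q - 1) * (k * q ^ \<mu>') + k * q ^ \<mu>' = k * q ^ \<mu>"
          using q by (cases q) (auto simp: Suc algebra_simps)
        show "k * q ^ \<mu> \<le> k * q ^ \<nu>"
          using q \<mu> by (intro mult_le_mono2 power_increasing) auto
      qed (use q True in \<open>simp_all add: Suc(1)\<close>)
      also have "L * q ^ \<mu> + k * q ^ \<nu> + 2 * q ^ \<nu> = card J"
        by (simp add: J_def I_def L(2,3) algebra_simps)
      finally show ?thesis .
    qed
    moreover have "finite J"
      by (simp add: J_def)
    ultimately obtain d j0 where d: "j0 \<in> J" "d j0 \<noteq> 0" "(\<Sum>j\<in>J. smult (d j) (A j)) = 0"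
      using exists_nontrivial_relation[of J A D] degA by metis
    define B where "B = (\<lambda>(i,j,l). monom 1 (l + i * q ^ \<nu>) * T\<nu> ^ j)"
    define E where "E = (\<Sum>j\<in>J. smult (d j) (B j))"
    have T\<nu>0: "T\<nu> \<noteq> 0"
      using deg_T\<nu> k L by auto
    have degB: "degree (B (i, j, l)) = l + L * (q * i + k * j)" for i j l
      using T\<nu>0 by (simp add: B_def degree_mult_eq degree_monom_eq degree_power_eq deg_T\<nu> L(2) algebra_simps)
    have E0: "E \<noteq> 0"
      unfolding E_def
    proof (rule linear_combination_distinct_degrees_nonzero)
      \<comment> \<open>The degree \<open>l + L * (q * i + k * j)\<close> is decoded digit by digit:
        modulo \<open>L\<close> it gives \<open>l\<close>, then modulo \<open>q\<close> it gives
        \<open>j\<close> because \<open>k\<close> is invertible there, and finally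
        \<open>i\<close>.\<close>
      show "inj_on (\<lambda>a. degree (B a)) J"
      proof (rule inj_onI)
        fix s t assume st: "s \<in> J" "t \<in> J" "degree (B s) = degree (B t)"
        obtain i j l i' j' l' where eq: "s = (i, j, l)" "t = (i', j', l')"
          by (cases s, cases t) auto
        have *: "l < L" "l' < L" "j < q" "j' < q"
          using st by (auto simp: J_def eq)
        have deg: "l + L * (q * i + k * j) = l' + L * (q * i' + k * j')"
          using st(3) by (simp add: eq degB)
        have "l = l'"
          using arg_cong[OF deg, of "\<lambda>n. n mod L"] * by simp
        moreover from this have qk: "q * i + k * j = q * i' + k * j'"
          using deg L(1) by simp
        moreover have "j = j'"
        proof -
          have "[k * j = k * j'] (mod q)"
            using arg_cong[OF qk, of "\<lambda>n. n mod q"] by (simp add: cong_def)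
          hence "[j = j'] (mod q)"
            using k(3) by (simp add: cong_mult_lcancel_nat q_def)
          thus ?thesis
            using * by (simp add: cong_def)
        qed
        ultimately show "s = t"
          using q by (simp add: eq)
      qed
      show "B a \<noteq> 0" if "a \<in> J" for a
        using T\<nu>0 by (auto simp: B_def split: prod.splits)
    qed (use d in \<open>auto simp: J_def\<close>)
    have "?X \<subseteq> {x. ac_eval E x = 0}"
    proof
      fix x assume "x \<in> ?X"
      hence x: "x ^ (q ^ (\<mu> + \<nu>)) = x" and tr: "ac_eval T\<nu> x ^ (q ^ \<mu>) = to_ac b - ac_eval T\<mu> x"
        using ac_eval_trace_poly_add[of \<mu> \<nu> h x] by (auto simp: q_def T\<mu>_def T\<nu>_def algebra_simps)
      have "ac_eval (B t) x ^ (q ^ \<mu>) = ac_eval (A t) x" for t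
      proof -
        obtain i j l where t: "t = (i, j, l)" by (cases t) auto
        have "(x ^ (i * q ^ \<nu>)) ^ (q ^ \<mu>) = (x ^ (q ^ (\<mu> + \<nu>))) ^ i"
          by (simp only: power_add power_mult[symmetric] mult_ac)
        moreover have "(ac_eval T\<nu> x ^ j) ^ (q ^ \<mu>) = (ac_eval T\<nu> x ^ (q ^ \<mu>)) ^ j"
          by (simp only: power_mult[symmetric] mult.commute)
        moreover have "ac_eval (B t) x ^ (q ^ \<mu>) =
          (x ^ l) ^ (q ^ \<mu>) * (x ^ (i * q ^ \<nu>)) ^ (q ^ \<mu>) * (ac_eval T\<nu> x ^ j) ^ (q ^ \<mu>)"
          by (simp add: t B_def power_mult_distrib power_add)
        moreover have "ac_eval (A t) x = (x ^ l) ^ (q ^ \<mu>) * x ^ i * (to_ac b - ac_eval T\<mu> x) ^ j"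
          by (simp add: t A_def power_add power_mult)
        ultimately show ?thesis
          by (simp only: x tr)
      qed
      \<comment> \<open>The coefficients \<open>d j\<close> come from the base field and are
        therefore unchanged by the power \<open>q ^ \<mu>\<close>.\<close>
      hence "ac_eval E x ^ (q ^ \<mu>) = ac_eval (\<Sum>j\<in>J. smult (d j) (A j)) x"
        by (simp add: E_def ac_eval_sum q_def frobenius_sum power_mult_distrib)
      thus "x \<in> {x. ac_eval E x = 0}"
        using d(3) by simp
    qed
    hence "card ?X \<le> card {x. ac_eval E x = 0}"
      using card_ac_eval_roots_le(1)[OF E0] by (rule card_mono[rotated])
    also have "\<dots> \<le> degree E"
      by (rule card_ac_eval_roots_le[OF E0])
    also have "degree E \<le> q ^ (\<mu> + \<nu> - 1) + (2 * k + 2) * q ^ \<nu>"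
      unfolding E_def
    proof (rule degree_sum_le)
      fix t assume "t \<in> J"
      then obtain i j l where t: "t = (i, j, l)" "i < I" "j < q" "l < L"
        by (cases t) (auto simp: J_def)
      have "degree (smult (d t) (B t)) \<le> degree (B t)"
        by (rule degree_smult_le)
      also have "\<dots> = l + L * (q * i + k * j)"
        by (simp add: t degB)
      \<comment> \<open>The part \<open>L * q * q ^ \<mu>'\<close> is the expected size
        \<open>q ^ (\<mu> + \<nu> - 1)\<close> of a fibre; everything else is the error
        term.\<close>
      also have "\<dots> \<le> L + L * (q * (q ^ \<mu>' + k + 1) + k * q)"
        using t by (intro add_mono mult_le_mono) (auto simp: I_def)
      also have "\<dots> \<le> q ^ \<mu>' * q ^ \<nu> + (2 * k + 2) * q ^ \<nu>"
        using q L(1) by (simp add: L(2) algebra_simps)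
      also have "q ^ \<mu>' * q ^ \<nu> = q ^ (\<mu> + \<nu> - 1)"
        by (simp add: Suc flip: power_add power_Suc)
      finally show "degree (smult (d t) (B t)) \<le> q ^ (\<mu> + \<nu> - 1) + (2 * k + 2) * q ^ \<nu>" .
    qed (simp add: J_def)
    finally show ?thesis
      by (simp add: q_def)
  qed
qed

section \<open>Distribution of traces\<close>

definition trace_count :: "'a::{field,finite} poly \<Rightarrow> nat \<Rightarrow> 'a \<Rightarrow> nat" where
  "trace_count h m b =
    card {x. x ^ (CARD('a) ^ m) = x \<and> ac_eval (trace_poly m h) x = to_ac b}"

text \<open>Twice the total variation distance between the distribution \<open>E\<^sub>m\<close> of
  the trace and the uniform one.\<close>

definition trace_deviation :: "'a::{field,finite} poly \<Rightarrow> nat \<Rightarrow> real" where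
  "trace_deviation h m =
    (\<Sum>b\<in>UNIV. \<bar>real (trace_count h m b) / real CARD('a) ^ m - 1 / real CARD('a)\<bar>)"

lemma sum_trace_count:
  fixes h :: "'a::{field,finite} poly"
  assumes "m \<ge> 1"
  shows "(\<Sum>b\<in>UNIV. trace_count h m b) = CARD('a) ^ m"
proof -
  let ?F = "{x::'a alg_closure. x ^ (CARD('a) ^ m) = x}"
  have "(\<Sum>b\<in>UNIV. trace_count h m b) =
    card (\<Union>b\<in>UNIV. {x. x \<in> ?F \<and> ac_eval (trace_poly m h) x = to_ac b})"
    unfolding trace_count_def mem_Collect_eq
    by (subst card_UN_disjoint) (use card_frobenius_fixed[OF assms, where 'a='a] in auto)
  also have "(\<Union>b\<in>UNIV. {x. x \<in> ?F \<and> ac_eval (trace_poly m h) x = to_ac b}) = ?F"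
    using trace_poly_fixed_in_base_field[of _ m h] by (auto simp: base_field_def)
  finally show ?thesis
    by (simp add: card_frobenius_fixed[OF assms])
qed

text \<open>Stepanov's method gives upper bounds only. They control the deviation from both sides
  because the deviations add up to 0: for \<open>y \<le> e\<close> and \<open>e \<ge> 0\<close> the
  absolute value of \<open>y\<close> is at most \<open>2 * e - y\<close>.\<close>

lemma sum_abs_deviation_le:
  fixes f :: "'i \<Rightarrow> real"
  assumes B: "finite B" and sum: "(\<Sum>b\<in>B. f b) = real (card B) * c"
    and up: "\<And>b. b \<in> B \<Longrightarrow> f b \<le> c + e" and e: "e \<ge> 0"
  shows "(\<Sum>b\<in>B. \<bar>f b - c\<bar>) \<le> 2 * real (card B) * e"
proof -
  have "(\<Sum>b\<in>B. \<bar>f b - c\<bar>) \<le> (\<Sum>b\<in>B. 2 * e - (f b - c))"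
    using up e by (intro sum_mono) (smt (verit))
  also have "\<dots> = 2 * real (card B) * e"
    using sum by (simp add: sum_subtractf)
  finally show ?thesis .
qed

lemma trace_deviation_le:
  fixes h :: "'a::{field,finite} poly"
  assumes k: "degree h = k" "k \<ge> 1" "coprime k CARD('a)" and m: "m \<ge> 2"
  shows "trace_deviation h m \<le> 4 * real (k + 1) * real CARD('a) ^ (1 + m - m div 2) / real CARD('a) ^ m"
proof -
  define q where "q = real CARD('a)"
  have q: "q > 0"
    by (simp add: q_def)
  \<comment> \<open>The most even splitting of \<open>m\<close> with the larger part as
    \<open>\<nu>\<close>: the error in \<open>card_trace_fibre_le\<close> is proportional to
    \<open>q ^ \<nu>\<close>.\<close>
  define \<nu> where "\<nu> = m - m div 2"
  have \<nu>: "m div 2 + \<nu> = m" "m div 2 \<ge> 1" "m div 2 \<le> \<nu>" "1 + m - m div 2 = Suc \<nu>"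
    using m by (auto simp: \<nu>_def)
  have "trace_deviation h m \<le> 2 * real CARD('a) * ((2 * real k + 2) * q ^ \<nu> / q ^ m)"
    unfolding trace_deviation_def
  proof (rule sum_abs_deviation_le, unfold q_def[symmetric])
    have "(\<Sum>b\<in>UNIV. real (trace_count h m b) / q ^ m) = real (\<Sum>b\<in>UNIV. trace_count h m b) / q ^ m"
      by (simp add: sum_divide_distrib)
    thus "(\<Sum>b\<in>UNIV. real (trace_count h m b) / q ^ m) = q * (1 / q)"
      using m by (subst (asm) sum_trace_count) (simp_all add: q_def)
  next
    fix b :: 'a
    have "trace_count h m b \<le> CARD('a) ^ (m - 1) + (2 * k + 2) * CARD('a) ^ \<nu>"
      using card_trace_fibre_le[OF k \<nu>(2,3), of b] by (simp add: trace_count_def \<nu>(1))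
    hence "real (trace_count h m b) \<le> real (CARD('a) ^ (m - 1) + (2 * k + 2) * CARD('a) ^ \<nu>)"
      by (simp only: of_nat_le_iff)
    also have "\<dots> = q ^ (m - 1) + (2 * real k + 2) * q ^ \<nu>"
      by (simp add: q_def algebra_simps)
    finally have "real (trace_count h m b) / q ^ m \<le> (q ^ (m - 1) + (2 * real k + 2) * q ^ \<nu>) / q ^ m"
      using q by (intro divide_right_mono) auto
    also have "\<dots> = 1 / q + (2 * real k + 2) * q ^ \<nu> / q ^ m"
      using q m by (simp add: add_divide_distrib power_diff)
    finally show "real (trace_count h m b) / q ^ m \<le> 1 / q + (2 * real k + 2) * q ^ \<nu> / q ^ m" .
  qed (use q in auto)
  also have "\<dots> = 4 * real (k + 1) * q ^ (1 + m - m div 2) / q ^ m"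
    unfolding \<nu>(4) by (simp add: q_def algebra_simps)
  finally show ?thesis
    by (simp only: q_def)
qed

text \<open>On the group of \<open>N\<close>-th roots of unity the powers \<open>k\<close> and
  \<open>gcd k N\<close> have the same kernel and, by Bezout, the same image; each nonempty fibre is
  a coset of the kernel.\<close>

lemma card_power_fibre_gcd:
  fixes y :: "'b::field" and N :: nat
  assumes k: "k \<ge> 1" and N: "N \<ge> 1" and y: "y \<noteq> 0"
  shows "card {x. x ^ N = 1 \<and> x ^ k = y} = card {x. x ^ N = 1 \<and> x ^ gcd k N = y}"
proof -
  define g where "g = gcd k N"
  obtain u v where uv: "k * u = N * v + g"
    using bezout_nat[of k N] k by (auto simp: g_def)
  have ku: "x ^ (k * u) = x ^ g" if "x ^ N = 1" for x :: 'b
    using that by (simp add: uv power_add power_mult)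
  have kernel: "x ^ k = 1 \<longleftrightarrow> x ^ g = 1" if "x ^ N = 1" for x :: 'b
  proof
    assume "x ^ k = 1"
    thus "x ^ g = 1"
      using ku[OF that] by (simp add: power_mult)
  next
    assume "x ^ g = 1"
    thus "x ^ k = 1"
      by (metis dvd_def g_def gcd_dvd1 power_mult power_one)
  qed
  have shift: "card {x. x ^ N = 1 \<and> x ^ e = y} = card {x::'b. x ^ N = 1 \<and> x ^ e = 1}"
    if "z ^ N = 1" "z ^ e = y" for z :: 'b and e
  proof (rule bij_betw_same_card[of "\<lambda>x. x / z"])
    have "z \<noteq> 0"
      using that(1) N by (auto simp: power_0_left)
    thus "bij_betw (\<lambda>x. x / z) {x. x ^ N = 1 \<and> x ^ e = y} {x. x ^ N = 1 \<and> x ^ e = 1}"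
      using that y by (intro bij_betwI[of _ _ _ "\<lambda>x. x * z"]) (auto simp: power_divide power_mult_distrib)
  qed
  show ?thesis
  proof (cases "\<exists>z. z ^ N = 1 \<and> z ^ k = y")
    case True
    then obtain z where z: "z ^ N = 1" "z ^ k = y" by blast
    have "(z ^ (k div g)) ^ N = 1" "(z ^ (k div g)) ^ g = y"
      using z by (auto simp: g_def mult.commute power_mult simp flip: power_mult)
         (metis mult.commute power_mult power_one)
    from shift[OF z] shift[OF this] show ?thesis
      using kernel by (auto simp: g_def intro!: arg_cong[where f = card])
  next
    case False
    have "\<not> (z ^ N = 1 \<and> z ^ g = y)" for z
      using False ku[of z] by (metis mult.commute power_mult power_one)
    hence "{x. x ^ N = 1 \<and> x ^ k = y} = {}" "{x. x ^ N = 1 \<and> x ^ g = y} = {}"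
      using False by auto
    thus ?thesis
      by (simp only: g_def)
  qed
qed

text \<open>Apart from 0, the field of size \<open>q ^ m\<close> consists of the roots of unity of
  order dividing \<open>q ^ m - 1\<close>. Grouping them by the value of the power reduces the claim
  to \<open>card_power_fibre_gcd\<close>.\<close>

lemma trace_count_monom:
  assumes k: "k \<ge> 1" and m: "m \<ge> 1"
  shows "trace_count (monom (1::'a::{field,finite}) k) m b =
    trace_count (monom 1 (gcd k (CARD('a) ^ m - 1))) m b"
proof -
  define Q where "Q = CARD('a) ^ m"
  define N where "N = Q - 1"
  have Q: "Q > 1"
    unfolding Q_def using m CARD_finite_field_gt_1[where 'a='a] by (intro one_less_power) auto
  define \<tau> where "\<tau> = (\<lambda>y::'a alg_closure. \<Sum>i<m. y ^ (CARD('a) ^ i))"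
  have fixed: "x ^ Q = x \<longleftrightarrow> x = 0 \<or> x ^ N = 1" for x :: "'a alg_closure"
    using Q by (cases "x = 0") (auto simp: N_def power_eq_if)
  have fin: "finite {x::'a alg_closure. x ^ N = 1}"
    by (rule finite_subset[OF _ card_frobenius_fixed(1)[OF m, where 'a='a]])
       (use fixed in \<open>auto simp flip: Q_def\<close>)
  have count: "trace_count (monom (1::'a) e) m b = of_bool (\<tau> 0 = to_ac b) +
     (\<Sum>y | y ^ N = 1 \<and> \<tau> y = to_ac b. card {x. x ^ N = 1 \<and> x ^ e = y})" if e: "e \<ge> 1" for e
  proof -
    have "trace_count (monom (1::'a) e) m b = card {x. x ^ Q = x \<and> \<tau> (x ^ e) = to_ac b}"
      by (simp add: trace_count_def ac_eval_trace_poly \<tau>_def Q_def)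
    also have "{x. x ^ Q = x \<and> \<tau> (x ^ e) = to_ac b} =
      {x::'a alg_closure. x = 0 \<and> \<tau> 0 = to_ac b} \<union> {x. x ^ N = 1 \<and> \<tau> (x ^ e) = to_ac b}"
      using e Q by (auto simp: fixed power_0_left)
    also have "card \<dots> = card {x::'a alg_closure. x = 0 \<and> \<tau> 0 = to_ac b} + card {x. x ^ N = 1 \<and> \<tau> (x ^ e) = to_ac b}"
      using fin Q by (intro card_Un_disjoint) (auto simp: N_def power_0_left)
    also have "card {x::'a alg_closure. x = 0 \<and> \<tau> 0 = to_ac b} = of_bool (\<tau> 0 = to_ac b)"
      by (cases "\<tau> 0 = to_ac b") auto
    also have "{x. x ^ N = 1 \<and> \<tau> (x ^ e) = to_ac b} =
      (\<Union>y\<in>{y. y ^ N = 1 \<and> \<tau> y = to_ac b}. {x. x ^ N = 1 \<and> x ^ e = y})"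
      by (auto simp: mult.commute simp flip: power_mult) (simp add: power_mult)
    also have "card \<dots> = (\<Sum>y | y ^ N = 1 \<and> \<tau> y = to_ac b. card {x. x ^ N = 1 \<and> x ^ e = y})"
      by (rule card_UN_disjoint) (use fin in auto)
    finally show ?thesis .
  qed
  have "card {x. x ^ N = 1 \<and> x ^ k = y} = card {x. x ^ N = 1 \<and> x ^ gcd k N = y}"
    if "y ^ N = 1" for y :: "'a alg_closure"
    using that k Q by (intro card_power_fibre_gcd) (auto simp: N_def power_0_left)
  moreover have "gcd k N \<ge> 1"
    using k by (simp add: Suc_le_eq)
  ultimately have "trace_count (monom (1::'a) k) m b = trace_count (monom 1 (gcd k N)) m b"
    using k by (simp add: count)
  thus ?thesis
    by (simp add: N_def Q_def)
qed

text \<open>The gcd divides \<open>q ^ m - 1\<close> and is thus prime to \<open>q\<close>, so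
  Stepanov's bound applies to it even if the characteristic divides \<open>k\<close>.\<close>

lemma trace_deviation_monom_le:
  assumes k: "k \<ge> 1" and m: "m \<ge> 2"
  shows "trace_deviation (monom (1::'a::{field,finite}) k) m \<le>
    4 * real (gcd k (CARD('a) ^ m - 1) + 1) * real CARD('a) ^ (1 + m - m div 2) / real CARD('a) ^ m"
proof -
  define g where "g = gcd k (CARD('a) ^ m - 1)"
  have g: "g \<ge> 1"
    using k by (simp add: g_def Suc_le_eq)
  have "coprime (CARD('a) ^ m - 1) (CARD('a) ^ m)"
    using coprime_diff_one_left_nat[of "CARD('a) ^ m"] by simp
  hence "coprime g CARD('a)"
    using m by (auto simp: g_def intro: coprime_imp_coprime dvd_trans)
  hence "trace_deviation (monom (1::'a) g) m \<le> 4 * real (g + 1) * real CARD('a) ^ (1 + m - m div 2) / real CARD('a) ^ m"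
    using g m by (intro trace_deviation_le) (simp_all add: degree_monom_eq)
  thus ?thesis
    using trace_count_monom[OF k, of m, where 'a='a] m by (simp add: trace_deviation_def g_def)
qed

section \<open>Sums over invariant multisets\<close>

abbreviation frob_msets :: "nat \<Rightarrow> 'a::{field,finite} alg_closure multiset set" where
  "frob_msets n \<equiv> invariant_msets (\<lambda>x. x ^ CARD('a)) n"

definition mset_eval :: "'a::field poly \<Rightarrow> 'a alg_closure multiset \<Rightarrow> 'a alg_closure" where
  "mset_eval h R = (\<Sum>r\<in>#R. ac_eval h r)"

text \<open>This is \<open>D\<^sub>n\<close>, computed by counting multisets;
  \<open>measure_eval_eq_value_freq\<close> identifies it with the actual probabilities.\<close>

definition value_freq :: "'a::{field,finite} poly \<Rightarrow> nat \<Rightarrow> 'a \<Rightarrow> real" where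
  "value_freq h n v = real (card {R \<in> frob_msets n. mset_eval h R = to_ac v}) / real CARD('a) ^ n"

lemma frob_fixed_finite:
  "1 \<le> m \<Longrightarrow> finite {a. ((\<lambda>x::'a::{field,finite} alg_closure. x ^ CARD('a)) ^^ m) a = a}"
  by (simp add: funpow_frobenius card_frobenius_fixed)

lemma finite_frob_msets: "finite (frob_msets n :: 'a::{field,finite} alg_closure multiset set)"
  by (rule finite_invariant_msets[OF inj_frobenius frob_fixed_finite])

lemma frob_msets_0: "frob_msets 0 = {{#}}"
  by (auto simp: invariant_msets_def)

lemma sum_frob_msets_rec:
  fixes F :: "'a::{field,finite} alg_closure multiset \<Rightarrow> real"
  shows "real n * (\<Sum>R\<in>frob_msets n. F R) =
    (\<Sum>m=1..n. \<Sum>a | a ^ (CARD('a) ^ m) = a. \<Sum>S\<in>frob_msets (n - m).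
      F (S + cycle_mset (\<lambda>x. x ^ CARD('a)) m a))"
  using sum_invariant_msets_rec[OF inj_frobenius frob_fixed_finite, of n F]
  by (simp only: funpow_frobenius)

text \<open>In the recursion for the constant function 1, induction makes each \<open>m\<close>
  contribute \<open>q ^ m * q ^ (n - m)\<close>, so the right-hand side is
  \<open>n * q ^ n\<close>.\<close>

lemma card_frob_msets: "card (frob_msets n :: 'a::{field,finite} alg_closure multiset set) = CARD('a) ^ n"
proof (induction n rule: less_induct)
  case (less n)
  show ?case
  proof (cases "n = 0")
    case False
    have "real n * real (card (frob_msets n :: 'a alg_closure multiset set)) =
      (\<Sum>m=1..n. \<Sum>a::'a alg_closure | a ^ (CARD('a) ^ m) = a. real (card (frob_msets (n - m) :: 'a alg_closure multiset set)))"
      using sum_frob_msets_rec[where 'a='a and n=n and F="\<lambda>_. 1"] by simp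
    also have "\<dots> = (\<Sum>m=1..n. real (CARD('a) ^ n))"
    proof (rule sum.cong[OF refl])
      fix m assume m: "m \<in> {1..n}"
      have "(\<Sum>a::'a alg_closure | a ^ (CARD('a) ^ m) = a. real (card (frob_msets (n - m) :: 'a alg_closure multiset set)))
        = real (CARD('a) ^ m * CARD('a) ^ (n - m))"
        using less[of "n - m"] m card_frobenius_fixed(2)[of m, where 'a='a] by simp
      thus "(\<Sum>a::'a alg_closure | a ^ (CARD('a) ^ m) = a. real (card (frob_msets (n - m) :: 'a alg_closure multiset set)))
        = real (CARD('a) ^ n)"
        using m by (simp only: flip: power_add) simp
    qed
    also have "\<dots> = real n * real (CARD('a) ^ n)"
      by simp
    finally show ?thesis
      using False by (simp only: mult_cancel_left of_nat_eq_0_iff of_nat_eq_iff) simp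
  qed (simp add: frob_msets_0)
qed

lemma mset_eval_add: "mset_eval h (R + S) = mset_eval h R + mset_eval h S"
  by (simp add: mset_eval_def)

lemma mset_eval_cycle:
  fixes h :: "'a::{field,finite} poly"
  shows "mset_eval h (cycle_mset (\<lambda>x. x ^ CARD('a)) m a) = ac_eval (trace_poly m h) a"
proof -
  have "mset_eval h (cycle_mset (\<lambda>x. x ^ CARD('a)) m a) = (\<Sum>i\<leftarrow>[0..<m]. ac_eval h (a ^ (CARD('a) ^ i)))"
    unfolding mset_eval_def cycle_mset_def funpow_frobenius
    by (simp flip: mset_map sum_mset_sum_list add: comp_def)
  also have "\<dots> = (\<Sum>i<m. ac_eval h a ^ (CARD('a) ^ i))"
    by (simp add: ac_eval_frobenius sum_list_distinct_conv_sum_set atLeast0LessThan)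
  finally show ?thesis
    by (simp add: ac_eval_trace_poly)
qed

lemma mset_eval_in_base_field:
  fixes h :: "'a::{field,finite} poly"
  assumes "R \<in> frob_msets n"
  shows "mset_eval h R \<in> base_field"
proof -
  have "mset_eval h R ^ CARD('a) = (\<Sum>r\<in>#R. ac_eval h (r ^ CARD('a)))"
    unfolding mset_eval_def
  proof (induction R)
    case (add x R)
    thus ?case
      using frobenius_add[where 'a='a and m=1] ac_eval_frobenius[of h x 1] by simp
  qed (use CARD_finite_field_gt_1[where 'a='a] in simp)
  also have "\<dots> = mset_eval h (image_mset (\<lambda>x. x ^ CARD('a)) R)"
    by (simp add: mset_eval_def multiset.map_comp comp_def)
  also have "\<dots> = mset_eval h R"
    using assms by (simp add: invariant_msets_def)
  finally show ?thesis
    by (simp add: base_field_iff)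
qed

lemma sum_value_freq: "(\<Sum>v\<in>UNIV. value_freq (h::'a::{field,finite} poly) n v) = 1"
proof -
  have "(\<Sum>v\<in>UNIV. card {R \<in> frob_msets n. mset_eval h R = to_ac v}) =
    card (\<Union>v\<in>UNIV. {R \<in> frob_msets n. mset_eval h R = to_ac v})"
    using finite_frob_msets[of n, where 'a='a] by (subst card_UN_disjoint) auto
  also have "(\<Union>v\<in>UNIV. {R \<in> frob_msets n. mset_eval h R = to_ac v}) = frob_msets n"
    using mset_eval_in_base_field[of _ n h] by (auto simp: base_field_def)
  finally have "(\<Sum>v\<in>UNIV. real (card {R \<in> frob_msets n. mset_eval h R = to_ac v})) = real CARD('a) ^ n"
    by (simp add: card_frob_msets flip: of_nat_sum)
  thus ?thesis
    by (simp add: value_freq_def flip: sum_divide_distrib)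
qed

text \<open>The general recursion for the indicator of the value \<open>v\<close>: removing a cycle
  through \<open>a\<close> lowers the target by the trace of \<open>h(a)\<close>, and the points
  \<open>a\<close> are grouped by this trace \<open>b\<close>.\<close>

lemma value_freq_rec:
  fixes h :: "'a::{field,finite} poly"
  shows "real n * value_freq h n v =
    (\<Sum>m=1..n. \<Sum>b\<in>UNIV. real (trace_count h m b) / real CARD('a) ^ m * value_freq h (n - m) (v - b))"
proof -
  let ?q = "real CARD('a)"
  let ?N = "\<lambda>n v. real (card {R \<in> frob_msets n. mset_eval h R = to_ac v})"
  have as_sum: "?N n v = (\<Sum>R\<in>frob_msets n. of_bool (mset_eval h R = to_ac v))" for n v
    using finite_frob_msets[of n, where 'a='a] by (simp add: sum.If_cases of_bool_def Collect_conj_eq)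
  have "real n * ?N n v = (\<Sum>m=1..n. \<Sum>a | a ^ (CARD('a) ^ m) = a. \<Sum>S\<in>frob_msets (n - m).
      of_bool (mset_eval h S + ac_eval (trace_poly m h) a = to_ac v))"
    unfolding as_sum by (subst sum_frob_msets_rec) (simp only: mset_eval_add mset_eval_cycle)
  also have "\<dots> = (\<Sum>m=1..n. \<Sum>b\<in>UNIV. real (trace_count h m b) * ?N (n - m) (v - b))"
  proof (rule sum.cong[OF refl])
    fix m assume m: "m \<in> {1..n}"
    let ?F = "{a::'a alg_closure. a ^ (CARD('a) ^ m) = a}"
    have "(\<Sum>a\<in>?F. \<Sum>S\<in>frob_msets (n - m). of_bool (mset_eval h S + ac_eval (trace_poly m h) a = to_ac v)) =
      (\<Sum>b\<in>UNIV. \<Sum>a\<in>{a\<in>?F. of_ac (ac_eval (trace_poly m h) a) = b}.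
        \<Sum>S\<in>frob_msets (n - m). of_bool (mset_eval h S + ac_eval (trace_poly m h) a = to_ac v :: bool) :: real)"
      using m card_frobenius_fixed(1)[of m, where 'a='a] by (intro sum.group[symmetric]) auto
    also have "\<dots> = (\<Sum>b\<in>UNIV. real (trace_count h m b) * ?N (n - m) (v - b))"
    proof (rule sum.cong[OF refl])
      fix b :: 'a
      have "{a\<in>?F. of_ac (ac_eval (trace_poly m h) a) = b} =
        {a. a ^ (CARD('a) ^ m) = a \<and> ac_eval (trace_poly m h) a = to_ac b}"
        using trace_poly_fixed_in_base_field[of _ m h] by (auto simp: base_field_def to_ac_of_ac)
      moreover have "mset_eval h S + to_ac b = to_ac v \<longleftrightarrow> mset_eval h S = to_ac (v - b)" for S
        by (auto simp: algebra_simps)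
      ultimately show "(\<Sum>a\<in>{a\<in>?F. of_ac (ac_eval (trace_poly m h) a) = b}.
        \<Sum>S\<in>frob_msets (n - m). of_bool (mset_eval h S + ac_eval (trace_poly m h) a = to_ac v))
        = real (trace_count h m b) * ?N (n - m) (v - b)"
        by (simp add: trace_count_def as_sum del: to_ac_diff)
    qed
    finally show "(\<Sum>a\<in>?F. \<Sum>S\<in>frob_msets (n - m). of_bool (mset_eval h S + ac_eval (trace_poly m h) a = to_ac v))
      = (\<Sum>b\<in>UNIV. real (trace_count h m b) * ?N (n - m) (v - b))" .
  qed
  finally have "real n * value_freq h n v =
    (\<Sum>m=1..n. \<Sum>b\<in>UNIV. real (trace_count h m b) * ?N (n - m) (v - b)) / ?q ^ n"
    by (simp add: value_freq_def)
  also have "\<dots> = (\<Sum>m=1..n. \<Sum>b\<in>UNIV. real (trace_count h m b) / ?q ^ m * value_freq h (n - m) (v - b))"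
    unfolding sum_divide_distrib
  proof (intro sum.cong refl)
    fix m b assume "m \<in> {1..n}"
    hence "?q ^ n = ?q ^ m * ?q ^ (n - m)"
      by (simp flip: power_add)
    thus "real (trace_count h m b) * ?N (n - m) (v - b) / ?q ^ n =
      real (trace_count h m b) / ?q ^ m * value_freq h (n - m) (v - b)"
      by (simp add: value_freq_def)
  qed
  finally show ?thesis .
qed

text \<open>Young's inequality for \<open>l1\<close> norms on a finite group.\<close>

lemma sum_abs_convolution_le:
  fixes a d :: "'g::{ab_group_add,finite} \<Rightarrow> real"
  shows "(\<Sum>v\<in>UNIV. \<bar>\<Sum>b\<in>UNIV. a b * d (v - b)\<bar>) \<le> (\<Sum>b\<in>UNIV. \<bar>a b\<bar>) * (\<Sum>v\<in>UNIV. \<bar>d v\<bar>)"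
proof -
  have shift: "(\<Sum>v\<in>UNIV. \<bar>d (v - b)\<bar>) = (\<Sum>v\<in>UNIV. \<bar>d v\<bar>)" for b
    by (rule sum.reindex_bij_witness[of _ "\<lambda>v. v + b" "\<lambda>v. v - b"]) auto
  have "(\<Sum>v\<in>UNIV. \<bar>\<Sum>b\<in>UNIV. a b * d (v - b)\<bar>) \<le> (\<Sum>v\<in>UNIV. \<Sum>b\<in>UNIV. \<bar>a b\<bar> * \<bar>d (v - b)\<bar>)"
    by (intro sum_mono order.trans[OF sum_abs]) (simp add: abs_mult)
  also have "\<dots> = (\<Sum>b\<in>UNIV. \<bar>a b\<bar> * (\<Sum>v\<in>UNIV. \<bar>d (v - b)\<bar>))"
    by (subst sum.swap) (simp add: sum_distrib_left)
  also have "\<dots> = (\<Sum>b\<in>UNIV. \<bar>a b\<bar>) * (\<Sum>v\<in>UNIV. \<bar>d v\<bar>)"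
    by (simp add: shift sum_distrib_right)
  finally show ?thesis .
qed

text \<open>The uniform distribution is preserved by every convolution, so the deviations satisfy
  the same recursion. A degree \<open>m\<close> with \<open>trace_deviation h m \<le> 1/2\<close>
  contracts them by 1/2, any other one does not expand them; the savings \<open>1 - t m\<close> are
  thus 1/2 or 0, whence the division by 2 in the exponent.\<close>

theorem value_freq_deviation_le:
  fixes h :: "'a::{field,finite} poly"
  assumes n: "n \<ge> 1"
  shows "(\<Sum>v\<in>UNIV. \<bar>value_freq h n v - 1 / real CARD('a)\<bar>) \<le>
    2 * exp (1 - (\<Sum>m | m \<in> {1..n} \<and> trace_deviation h m \<le> 1/2. 1 / real m) / 2)"
proof -
  define q where "q = real CARD('a)"
  have q: "q > 0"
    by (simp add: q_def)
  define \<delta> where "\<delta> = (\<lambda>n v. value_freq h n v - 1 / q)"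
  define e where "e = (\<lambda>m b. real (trace_count h m b) / q ^ m)"
  define \<Delta> where "\<Delta> = (\<lambda>n. \<Sum>v\<in>UNIV. \<bar>\<delta> n v\<bar>)"
  define t where "t = (\<lambda>m. if trace_deviation h m \<le> 1/2 then 1/2 else (1::real))"
  have sum_\<delta>: "(\<Sum>v\<in>UNIV. \<delta> n v) = 0" for n
    using q by (simp add: \<delta>_def sum_subtractf sum_value_freq) (simp add: q_def)
  have sum_\<delta>': "(\<Sum>b\<in>UNIV. \<delta> n (v - b)) = 0" for n v
  proof -
    have "(\<Sum>b\<in>UNIV. \<delta> n (v - b)) = (\<Sum>b\<in>UNIV. \<delta> n b)"
      by (rule sum.reindex_bij_witness[of _ "\<lambda>b. v - b" "\<lambda>b. v - b"]) auto
    thus ?thesis by (simp add: sum_\<delta>)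
  qed
  have sum_e: "(\<Sum>b\<in>UNIV. e m b) = 1" if "m \<ge> 1" for m
    using sum_trace_count[OF that, of h] q
    by (simp add: e_def q_def flip: sum_divide_distrib of_nat_sum)
  have rec: "real n * \<delta> n v = (\<Sum>m=1..n. \<Sum>b\<in>UNIV. e m b * \<delta> (n - m) (v - b))" for n v
  proof -
    have "real n * \<delta> n v = (\<Sum>m=1..n. \<Sum>b\<in>UNIV. e m b * value_freq h (n - m) (v - b)) - (\<Sum>m=1..n. 1 / q)"
      using value_freq_rec[of n h v] by (simp add: \<delta>_def e_def q_def right_diff_distrib)
    also have "\<dots> = (\<Sum>m=1..n. (\<Sum>b\<in>UNIV. e m b * value_freq h (n - m) (v - b)) - (\<Sum>b\<in>UNIV. e m b) * (1 / q))"
      by (simp add: sum_subtractf sum_e)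
    also have "\<dots> = (\<Sum>m=1..n. \<Sum>b\<in>UNIV. e m b * \<delta> (n - m) (v - b))"
      by (simp add: \<delta>_def right_diff_distrib sum_subtractf sum_distrib_right sum_divide_distrib)
    finally show ?thesis .
  qed
  have conv: "(\<Sum>v\<in>UNIV. \<bar>\<Sum>b\<in>UNIV. e m b * \<delta> l (v - b)\<bar>) \<le> t m * \<Delta> l" if m: "m \<ge> 1" for m l
  proof (cases "trace_deviation h m \<le> 1/2")
    case False
    have "e m b \<ge> 0" for b
      using q by (simp add: e_def)
    hence "(\<Sum>b\<in>UNIV. \<bar>e m b\<bar>) = 1"
      using sum_e[OF m] by simp
    thus ?thesis
      using sum_abs_convolution_le[of "e m" "\<delta> l"] False by (simp add: t_def \<Delta>_def)
  next
    case True
    \<comment> \<open>As \<open>\<delta> l\<close> has total sum 0, the constant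
      \<open>1 / q\<close> may be subtracted from \<open>e m\<close>; this replaces its norm 1 by
      the trace deviation.\<close>
    have "(\<Sum>b\<in>UNIV. e m b * \<delta> l (v - b)) = (\<Sum>b\<in>UNIV. (e m b - 1 / q) * \<delta> l (v - b))" for v
      using sum_\<delta>'[of l v] by (simp add: left_diff_distrib sum_subtractf flip: sum_divide_distrib)
    hence "(\<Sum>v\<in>UNIV. \<bar>\<Sum>b\<in>UNIV. e m b * \<delta> l (v - b)\<bar>) \<le> (\<Sum>b\<in>UNIV. \<bar>e m b - 1 / q\<bar>) * \<Delta> l"
      using sum_abs_convolution_le[of "\<lambda>b. e m b - 1 / q" "\<delta> l"] by (simp add: \<Delta>_def)
    also have "\<dots> \<le> (1/2) * \<Delta> l"
      using True by (intro mult_right_mono) (auto simp: trace_deviation_def e_def q_def \<Delta>_def intro: sum_nonneg)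
    finally show ?thesis
      using True by (simp add: t_def)
  qed
  have "\<Delta> n \<le> \<Delta> 0 * exp (1 - (\<Sum>m=1..n. (1 - t m) / real m))"
  proof (rule log_derivative_recursion_bound[OF _ _ _ _ n])
    fix n
    have "real n * \<Delta> n = (\<Sum>v\<in>UNIV. \<bar>real n * \<delta> n v\<bar>)"
      by (simp add: \<Delta>_def abs_mult sum_distrib_left)
    also have "\<dots> \<le> (\<Sum>v\<in>UNIV. \<Sum>m=1..n. \<bar>\<Sum>b\<in>UNIV. e m b * \<delta> (n - m) (v - b)\<bar>)"
      unfolding rec by (intro sum_mono sum_abs)
    also have "\<dots> = (\<Sum>m=1..n. \<Sum>v\<in>UNIV. \<bar>\<Sum>b\<in>UNIV. e m b * \<delta> (n - m) (v - b)\<bar>)"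
      by (rule sum.swap)
    also have "\<dots> \<le> (\<Sum>m=1..n. t m * \<Delta> (n - m))"
      by (intro sum_mono conv) auto
    finally show "real n * \<Delta> n \<le> (\<Sum>m=1..n. t m * \<Delta> (n - m))" .
  qed (auto simp: t_def \<Delta>_def intro: sum_nonneg)
  also have "\<dots> \<le> 2 * exp (1 - (\<Sum>m=1..n. (1 - t m) / real m))"
  proof (rule mult_right_mono)
    have "\<Delta> 0 \<le> (\<Sum>v\<in>UNIV. value_freq h 0 v + 1 / q)"
      unfolding \<Delta>_def \<delta>_def
    proof (rule sum_mono)
      fix v
      have "value_freq h 0 v \<ge> 0"
        by (simp add: value_freq_def)
      thus "\<bar>value_freq h 0 v - 1 / q\<bar> \<le> value_freq h 0 v + 1 / q"
        using q by (simp add: abs_le_iff)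
    qed
    also have "\<dots> = 2"
      using q by (simp add: sum.distrib sum_value_freq) (simp add: q_def)
    finally show "\<Delta> 0 \<le> 2" .
  qed simp
  also have "(\<Sum>m=1..n. (1 - t m) / real m) = (\<Sum>m=1..n. if trace_deviation h m \<le> 1/2 then 1 / real m / 2 else 0)"
    by (intro sum.cong) (auto simp: t_def)
  also have "\<dots> = (\<Sum>m | m \<in> {1..n} \<and> trace_deviation h m \<le> 1/2. 1 / real m / 2)"
    by (rule sum.inter_filter[symmetric]) auto
  also have "\<dots> = (\<Sum>m | m \<in> {1..n} \<and> trace_deviation h m \<le> 1/2. 1 / real m) / 2"
    by (simp add: sum_divide_distrib)
  finally show ?thesis
    by (simp add: \<Delta>_def \<delta>_def q_def)
qed

section \<open>Random tuples\<close>

text \<open>Vieta's formulas. The factors \<open>X + t i\<close> avoid signs in the coefficients, at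
  the price that the roots are the \<open>- t i\<close>.\<close>

lemma coeff_prod_linear_factors:
  fixes t :: "nat \<Rightarrow> 'b::comm_ring_1"
  shows "coeff (\<Prod>i\<in>{1..n}. [:t i, 1:]) l = (if l \<le> n then elem_sym (n - l) n t else 0)"
proof -
  have "(\<Prod>i\<in>{1..n}. [:t i, 1:]) = (\<Prod>i\<in>{1..n}. [:t i:] + monom 1 1)"
    by (simp add: monom_Suc monom_0)
  also have "\<dots> = (\<Sum>S\<in>Pow {1..n}. (\<Prod>i\<in>S. [:t i:]) * (\<Prod>i\<in>{1..n} - S. monom 1 1))"
    by (rule prod_add) simp
  also have "\<dots> = (\<Sum>S\<in>Pow {1..n}. monom (\<Prod>i\<in>S. t i) (n - card S))"
  proof (rule sum.cong[OF refl])
    fix S assume S: "S \<in> Pow {1..n}"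
    have "(\<Prod>i\<in>S. [:t i:]) = [:\<Prod>i\<in>S. t i:]"
      by (induction S rule: infinite_finite_induct) (auto simp: one_pCons)
    moreover have "(\<Prod>i\<in>{1..n} - S. monom (1::'b) 1) = monom 1 (n - card S)"
      using S by (auto simp: monom_power card_Diff_subset finite_subset)
    ultimately show "(\<Prod>i\<in>S. [:t i:]) * (\<Prod>i\<in>{1..n} - S. monom 1 1) = monom (\<Prod>i\<in>S. t i) (n - card S)"
      by (simp add: smult_monom)
  qed
  finally have "coeff (\<Prod>i\<in>{1..n}. [:t i, 1:]) l =
      (\<Sum>S\<in>Pow {1..n}. if n - card S = l then \<Prod>i\<in>S. t i else 0)"
    by (simp add: coeff_sum coeff_monom)
  also have "\<dots> = (\<Sum>S\<in>{S\<in>Pow {1..n}. n - card S = l}. \<Prod>i\<in>S. t i)"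
    by (rule sum.inter_filter[symmetric]) simp
  also have "\<dots> = (if l \<le> n then elem_sym (n - l) n t else 0)"
  proof (cases "l \<le> n")
    case True
    have "n - card S = l \<longleftrightarrow> card S = n - l" if "S \<subseteq> {1..n}" for S
      using card_mono[of "{1..n}" S] that True by auto
    hence "{S\<in>Pow {1..n}. n - card S = l} = {S. S \<subseteq> {1..n} \<and> card S = n - l}"
      by blast
    thus ?thesis
      using True by (simp add: elem_sym_def)
  next
    case False
    hence "{S\<in>Pow {1..n}. n - card S = l} = {}"
      by auto
    thus ?thesis
      using False by (simp only:) simp
  qed
  finally show ?thesis .
qed

text \<open>Both sides say that the products of the \<open>X + s i\<close> and of the
  \<open>X + t i\<close> agree: the elementary symmetric polynomials are the coefficients, the
  multiset is recovered from the roots.\<close>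

lemma mset_eq_iff_elem_sym:
  fixes s t :: "nat \<Rightarrow> 'b::idom"
  shows "image_mset s (mset_set {1..n}) = image_mset t (mset_set {1..n}) \<longleftrightarrow>
    (\<forall>j\<in>{1..n}. elem_sym j n s = elem_sym j n t)"
proof -
  have prod_eq: "(\<Prod>i\<in>{1..n}. [:u i, 1:]) = (\<Prod>x\<in>#image_mset u (mset_set {1..n}). [:x, 1:])" for u :: "nat \<Rightarrow> 'b"
    by (simp add: prod_unfold_prod_mset multiset.map_comp comp_def)
  show ?thesis
  proof
    assume "image_mset s (mset_set {1..n}) = image_mset t (mset_set {1..n})"
    hence "(\<Prod>i\<in>{1..n}. [:s i, 1:]) = (\<Prod>i\<in>{1..n}. [:t i, 1:])"
      by (simp only: prod_eq)
    hence "coeff (\<Prod>i\<in>{1..n}. [:s i, 1:]) (n - j) = coeff (\<Prod>i\<in>{1..n}. [:t i, 1:]) (n - j)" for j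
      by (simp only:)
    hence "elem_sym (n - (n - j)) n s = elem_sym (n - (n - j)) n t" for j
      unfolding coeff_prod_linear_factors by simp
    thus "\<forall>j\<in>{1..n}. elem_sym j n s = elem_sym j n t"
      by (metis atLeastAtMost_iff diff_diff_cancel)
  next
    assume eq: "\<forall>j\<in>{1..n}. elem_sym j n s = elem_sym j n t"
    have "elem_sym 0 n u = 1" for u :: "nat \<Rightarrow> 'b"
    proof -
      have "{S. S \<subseteq> {1..n} \<and> card S = 0} = {{}}"
        by (auto simp: finite_subset)
      thus ?thesis by (simp add: elem_sym_def)
    qed
    hence "elem_sym j n s = elem_sym j n t" if "j \<le> n" for j
      using eq that by (cases "j = 0") auto
    hence "(\<Prod>i\<in>{1..n}. [:s i, 1:]) = (\<Prod>i\<in>{1..n}. [:t i, 1:])"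
      unfolding poly_eq_iff coeff_prod_linear_factors by simp
    hence "image_mset uminus (image_mset s (mset_set {1..n})) = image_mset uminus (image_mset t (mset_set {1..n}))"
      unfolding prod_eq proots_prod_linear_factors[symmetric] by (simp only:)
    from arg_cong[OF this, of "image_mset uminus"]
    show "image_mset s (mset_set {1..n}) = image_mset t (mset_set {1..n})"
      by (simp add: multiset.map_comp comp_def)
  qed
qed

lemma ex_tuple_of_mset: "\<exists>t. image_mset t (mset_set {1..size R}) = R"
proof -
  obtain xs where xs: "mset xs = R"
    using ex_mset by blast
  have "map (\<lambda>i. xs ! (i - 1)) [1..<Suc (length xs)] = xs"
    by (rule nth_equalityI) (auto simp del: upt_Suc)
  hence "mset (map (\<lambda>i. xs ! (i - 1)) [1..<Suc (length xs)]) = R"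
    by (simp only: xs)
  moreover have "mset_set {1..size R} = mset [1..<Suc (length xs)]"
    by (simp only: mset_upt atLeastLessThanSuc_atLeastAtMost size_mset flip: xs)
  ultimately show ?thesis
    by (intro exI[of _ "\<lambda>i. xs ! (i - 1)"]) (simp only: mset_map)
qed

text \<open>Frobenius merely rearranges the tuple. So every invariant multiset corresponds to a
  point of the set on which uniformity is assumed.\<close>

lemma elem_sym_in_base_field:
  fixes t :: "nat \<Rightarrow> 'a::{field,finite} alg_closure"
  assumes "image_mset t (mset_set {1..n}) \<in> frob_msets n" and j: "j \<in> {1..n}"
  shows "elem_sym j n t \<in> base_field"
proof -
  have "elem_sym j n t ^ CARD('a) = elem_sym j n (\<lambda>i. t i ^ CARD('a))"
    unfolding elem_sym_def using frobenius_sum[of "\<lambda>S. \<Prod>i\<in>S. t i" _ 1]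
    by (simp only: power_one_right prod_power_distrib)
  also have "\<dots> = elem_sym j n t"
  proof -
    have "image_mset (\<lambda>i. t i ^ CARD('a)) (mset_set {1..n}) = image_mset t (mset_set {1..n})"
      using assms(1) by (simp add: invariant_msets_def multiset.map_comp comp_def)
    from this[unfolded mset_eq_iff_elem_sym] j show ?thesis
      by (rule bspec)
  qed
  finally show ?thesis
    by (simp add: base_field_iff)
qed

text \<open>Addition is a function of two discrete variables; measurability of the sum follows by
  fixing one summand and running through its countably many values.\<close>

lemma measurable_sum_count_space:
  fixes f :: "'i \<Rightarrow> 'w \<Rightarrow> 'b::comm_monoid_add"
  assumes "countable (UNIV :: 'b set)" and "\<And>i. i \<in> I \<Longrightarrow> f i \<in> measurable M (count_space UNIV)"
  shows "(\<lambda>w. \<Sum>i\<in>I. f i w) \<in> measurable M (count_space UNIV)"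
  using assms(2)
proof (induction I rule: infinite_finite_induct)
  case (insert i I)
  have IH: "(\<lambda>w. \<Sum>i\<in>I. f i w) \<in> measurable M (count_space UNIV)"
    by (rule insert.IH) (simp add: insert.prems)
  have "(\<lambda>w. a + (\<Sum>i\<in>I. f i w)) \<in> measurable M (count_space UNIV)" for a
    by (rule measurable_compose[OF IH]) (rule measurable_count_space)
  moreover have "f i \<in> measurable M (count_space UNIV)"
    by (rule insert.prems) simp
  ultimately have "(\<lambda>w. f i w + (\<Sum>i\<in>I. f i w)) \<in> measurable M (count_space UNIV)"
    by (rule measurable_compose_countable'[OF _ _ assms(1)])
  thus ?case
    by (simp only: sum.insert[OF insert.hyps])
qed simp_all

text \<open>Each invariant multiset is hit with probability \<open>q ^ (- n)\<close>, and there are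
  \<open>q ^ n\<close> of them, so they carry the whole mass.\<close>

lemma measure_eval_eq_value_freq:
  fixes h :: "'a::{field,finite} poly" and x :: "nat \<Rightarrow> 'w \<Rightarrow> 'a alg_closure"
  assumes M: "prob_space M"
    and rv: "\<And>i. i \<in> {1..n} \<Longrightarrow> x i \<in> measurable M (count_space UNIV)"
    and unif: "uniformly_distributed_on M (\<lambda>w. \<lambda>j\<in>{1..n}. elem_sym j n (\<lambda>i. x i w))
        ({1..n} \<rightarrow>\<^sub>E base_field)"
  shows "measure M {w \<in> space M. (\<Sum>i\<in>{1..n}. ac_eval h (x i w)) = to_ac v} = value_freq h n v"
proof -
  interpret prob_space M by fact
  define Z where "Z = (\<lambda>w. image_mset (\<lambda>i. x i w) (mset_set {1..n}))"
  define Y where "Y = (\<lambda>w. \<Sum>i\<in>{1..n}. ac_eval h (x i w))"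
  have YZ: "Y w = mset_eval h (Z w)" for w
    by (simp add: Y_def Z_def mset_eval_def sum_unfold_sum_mset multiset.map_comp comp_def)
  have prob_R: "prob {w \<in> space M. Z w = R} = 1 / real CARD('a) ^ n" if R: "R \<in> frob_msets n" for R
  proof -
    have "size R = n"
      using R by (simp add: invariant_msets_def)
    then obtain t where t: "image_mset t (mset_set {1..n}) = R"
      using ex_tuple_of_mset[of R] by auto
    let ?e = "\<lambda>j\<in>{1..n}. elem_sym j n t"
    have "Z w = R \<longleftrightarrow> (\<lambda>j\<in>{1..n}. elem_sym j n (\<lambda>i. x i w)) = ?e" for w
      unfolding Z_def t[symmetric] mset_eq_iff_elem_sym by (auto simp: fun_eq_iff)
    moreover have "?e \<in> {1..n} \<rightarrow>\<^sub>E base_field"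
      using elem_sym_in_base_field[of t n] R t by auto
    moreover have "card ({1..n} \<rightarrow>\<^sub>E (base_field :: 'a alg_closure set)) = CARD('a) ^ n"
      by (simp add: card_PiE card_base_field)
    ultimately show ?thesis
      using unif by (simp add: uniformly_distributed_on_def)
  qed
  \<comment> \<open>\<open>measure\<close> is 0 outside the sigma-algebra, so a set of nonzero
    measure must be an event.\<close>
  have sets_R: "{w \<in> space M. Z w = R} \<in> events" if "R \<in> frob_msets n" for R
    using prob_R[OF that] measure_notin_sets[of "{w \<in> space M. Z w = R}" M] by fastforce
  define A where "A = (\<lambda>v. \<Union>R\<in>{R \<in> frob_msets n. mset_eval h R = to_ac v}. {w \<in> space M. Z w = R})"
  have fin: "finite {R \<in> frob_msets n. mset_eval h R = to_ac v}" for v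
    using finite_frob_msets[of n, where 'a='a] by simp
  have prob_A: "prob (A v) = value_freq h n v" for v
  proof -
    have "prob (A v) = (\<Sum>R\<in>{R \<in> frob_msets n. mset_eval h R = to_ac v}. prob {w \<in> space M. Z w = R})"
      unfolding A_def by (rule finite_measure_finite_Union) (use fin sets_R in \<open>auto simp: disjoint_family_on_def\<close>)
    also have "\<dots> = value_freq h n v"
      by (simp add: prob_R value_freq_def)
    finally show ?thesis .
  qed
  have "Y \<in> measurable M (count_space UNIV)"
    unfolding Y_def using rv
    by (intro measurable_sum_count_space[OF countable_alg_closure] measurable_compose[OF rv]) auto
  hence sets_Y: "{w \<in> space M. Y w = c} \<in> events" for c
    using measurable_sets[of Y M "count_space UNIV" "{c}"] by (simp add: vimage_def Int_def conj_commute)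
  have A_le: "prob (A v) \<le> prob {w \<in> space M. Y w = to_ac v}" for v
    using sets_Y by (intro finite_measure_mono) (auto simp: A_def YZ)
  \<comment> \<open>The \<open>A v\<close> already have total mass 1, while the larger disjoint
    events \<open>Y w = to_ac v\<close> have at most 1; hence each pair has equal
    probability.\<close>
  have "(\<Sum>v\<in>UNIV. prob {w \<in> space M. Y w = to_ac v}) = prob (\<Union>v\<in>UNIV. {w \<in> space M. Y w = to_ac v})"
    using sets_Y by (intro finite_measure_finite_Union[symmetric]) (auto simp: disjoint_family_on_def)
  also have "\<dots> \<le> 1"
    by (rule prob_le_1)
  finally have "(\<Sum>v\<in>UNIV. prob {w \<in> space M. Y w = to_ac v} - prob (A v)) \<le> 0"
    by (simp add: sum_subtractf prob_A sum_value_freq)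
  moreover have "(\<Sum>v\<in>UNIV. prob {w \<in> space M. Y w = to_ac v} - prob (A v)) \<ge> 0"
    using A_le by (intro sum_nonneg) simp
  ultimately have "(\<Sum>v\<in>UNIV. prob {w \<in> space M. Y w = to_ac v} - prob (A v)) = 0"
    by simp
  hence "prob {w \<in> space M. Y w = to_ac v} - prob (A v) = 0"
    using A_le by (subst (asm) sum_nonneg_eq_0_iff) auto
  thus ?thesis
    by (simp add: Y_def prob_A)
qed

lemma tends_to_uniform_if_deviation_small:
  fixes h :: "nat \<Rightarrow> 'a::{field,finite} poly" and M :: "nat \<Rightarrow> 'w measure"
    and x :: "nat \<Rightarrow> nat \<Rightarrow> 'w \<Rightarrow> 'a alg_closure"
  assumes prob: "\<And>n. n \<ge> 1 \<Longrightarrow> prob_space (M n)"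
    and rv: "\<And>n i. n \<ge> 1 \<Longrightarrow> i \<in> {1..n} \<Longrightarrow> x n i \<in> measurable (M n) (count_space UNIV)"
    and unif: "\<And>n. n \<ge> 1 \<Longrightarrow>
      uniformly_distributed_on (M n)
        (\<lambda>w. \<lambda>j\<in>{1..n}. elem_sym j n (\<lambda>i. x n i w))
        ({1..n} \<rightarrow>\<^sub>E base_field)"
    and Y: "\<And>n w. n \<ge> 1 \<Longrightarrow> Y n w = (\<Sum>i\<in>{1..n}. ac_eval (h n) (x n i w))"
    and lim: "filterlim (\<lambda>n. \<Sum>m | m \<in> {1..n} \<and> trace_deviation (h n) m \<le> 1/2. 1 / real m) at_top sequentially"
  shows "tends_to_uniform_on M Y base_field"
  unfolding tends_to_uniform_on_def
proof
  fix c :: "'a alg_closure" assume "c \<in> base_field"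
  then obtain v where c: "c = to_ac v"
    by (auto simp: base_field_def)
  define S where "S = (\<lambda>n. \<Sum>m | m \<in> {1..n} \<and> trace_deviation (h n) m \<le> 1/2. 1 / real m)"
  have "norm (measure (M n) {w \<in> space (M n). Y n w = c} - 1 / real CARD('a)) \<le> 2 * exp (1 - S n / 2)"
    if n: "n \<ge> 1" for n
  proof -
    have "measure (M n) {w \<in> space (M n). Y n w = c} = value_freq (h n) n v"
      using measure_eval_eq_value_freq[OF prob[OF n] rv[OF n] unif[OF n], of "h n" v]
      by (simp add: Y[OF n] c)
    moreover have "\<bar>value_freq (h n) n v - 1 / real CARD('a)\<bar> \<le>
        (\<Sum>v\<in>UNIV. \<bar>value_freq (h n) n v - 1 / real CARD('a)\<bar>)"
      by (rule member_le_sum) auto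
    ultimately show ?thesis
      using value_freq_deviation_le[OF n, of "h n"] by (simp add: S_def)
  qed
  hence "\<forall>\<^sub>F n in sequentially. norm (measure (M n) {w \<in> space (M n). Y n w = c} - 1 / real CARD('a)) \<le> 2 * exp (1 - S n / 2)"
    using eventually_ge_at_top[of 1] by (rule eventually_mono[rotated])
  moreover have "((\<lambda>n. 2 * exp (1 - S n / 2)) \<longlongrightarrow> 0) sequentially"
  proof -
    have "((\<lambda>s::real. 2 * exp (1 - s / 2)) \<longlongrightarrow> 0) at_top"
      by real_asymp
    thus ?thesis
      by (rule filterlim_compose) (use lim in \<open>simp add: S_def\<close>)
  qed
  ultimately have "(\<lambda>n. measure (M n) {w \<in> space (M n). Y n w = c} - 1 / real CARD('a)) \<longlonglongrightarrow> 0"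
    by (rule Lim_null_comparison)
  hence "(\<lambda>n. measure (M n) {w \<in> space (M n). Y n w = c}) \<longlonglongrightarrow> 1 / real CARD('a)"
    by (subst (asm) LIM_zero_iff)
  thus "(\<lambda>n. measure (M n) {w \<in> space (M n). Y n w = c}) \<longlonglongrightarrow> 1 / real (card (base_field :: 'a alg_closure set))"
    by (simp add: card_base_field)
qed

section \<open>Large greatest common divisors\<close>

definition aliquot_sum :: "nat \<Rightarrow> nat" where
  "aliquot_sum d = (\<Sum>e | e dvd d \<and> e < d. e)"

lemma gcd_lcm_dvd:
  fixes a x y P :: nat
  assumes "gcd a x dvd P" "gcd a y dvd P"
  shows "gcd a (lcm x y) dvd P"
  using assms by (simp add: gcd_lcm_distrib)

lemma gcd_Lcm_dvd:
  fixes a P :: nat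
  assumes "finite A" "\<And>x. x \<in> A \<Longrightarrow> gcd a x dvd P"
  shows "gcd a (Lcm A) dvd P"
  using assms by (induction A rule: finite_induct) (auto simp: gcd_lcm_dvd)

text \<open>Bezout in the exponent: modulo \<open>x\<close> both \<open>q ^ a\<close> and
  \<open>q ^ b\<close> are 1, hence so is \<open>q ^ gcd a b\<close>.\<close>

lemma dvd_power_gcd_minus_one:
  fixes q x :: nat
  assumes q: "q \<ge> 1" and a: "a \<ge> 1" and x: "x dvd q ^ a - 1" "x dvd q ^ b - 1"
  shows "x dvd q ^ gcd a b - 1"
proof -
  have iff: "x dvd q ^ c - 1 \<longleftrightarrow> [q ^ c = 1] (mod x)" for c
    using q by (metis cong_altdef_nat cong_sym_eq one_le_power)
  obtain u v where uv: "a * u = b * v + gcd a b"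
    using bezout_nat[of a b] a by auto
  have "[q ^ (a * u) = 1] (mod x)" "[q ^ (b * v) = 1] (mod x)"
    using x[unfolded iff] cong_pow[of "q ^ a" 1 x u] cong_pow[of "q ^ b" 1 x v] by (simp_all add: power_mult)
  hence "[q ^ (b * v) * q ^ gcd a b = 1] (mod x)" "[q ^ (b * v) * q ^ gcd a b = 1 * q ^ gcd a b] (mod x)"
    using cong_scalar_right[of "q ^ (b * v)" 1 x "q ^ gcd a b"] by (simp_all only: uv power_add)
  hence "[q ^ gcd a b = 1] (mod x)"
    by (metis cong_sym cong_trans mult_1)
  thus ?thesis
    by (simp only: iff)
qed

context
  fixes q k :: nat
  assumes q: "q \<ge> 2" and k: "k \<ge> 1"
begin

text \<open>The complement of the gcd condition in (3), used for (1) as well. The factor 1/3 has to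
  lie below 1/2 for Stepanov's bound and above 1/4, the bound obtained below for the average of
  \<open>aliquot_sum d / d\<close> over odd \<open>d\<close>.\<close>

definition large_gcd :: "nat \<Rightarrow> bool" where
  "large_gcd d \<longleftrightarrow> real q powr (real d / 3) \<le> real (gcd k (q ^ d - 1))"

text \<open>The overlap with a single \<open>d' < d\<close> divides \<open>q ^ gcd d d' - 1\<close>,
  and \<open>gcd d d'\<close> is a proper divisor of \<open>d\<close>. The product over all proper
  divisors therefore absorbs all overlaps at once.\<close>

lemma gcd_with_earlier_le:
  assumes d: "d \<ge> 1" and A: "A \<subseteq> {1..<d}"
  shows "gcd (gcd k (q ^ d - 1)) (Lcm ((\<lambda>d. gcd k (q ^ d - 1)) ` A)) \<le> q ^ aliquot_sum d"
proof -
  define P where "P = (\<Prod>e | e dvd d \<and> e < d. q ^ e - 1)"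
  have fin: "finite {e. e dvd d \<and> e < d}"
    by (rule finite_subset[of _ "{..<d}"]) auto
  have pos: "q ^ e - 1 > 0" if "e dvd d" for e
  proof -
    have "e > 0"
      using that d by (intro Nat.gr0I) auto
    thus ?thesis
      using q one_less_power[of q e] by simp
  qed
  have "P > 0"
    unfolding P_def using pos by (intro prod_pos) auto
  moreover have "gcd (gcd k (q ^ d - 1)) (Lcm ((\<lambda>d. gcd k (q ^ d - 1)) ` A)) dvd P"
  proof (rule gcd_Lcm_dvd)
    show "finite ((\<lambda>d. gcd k (q ^ d - 1)) ` A)"
      using A finite_subset by blast
    fix y assume "y \<in> (\<lambda>d. gcd k (q ^ d - 1)) ` A"
    then obtain d' where d': "d' \<in> A" "y = gcd k (q ^ d' - 1)" by blast
    have "gcd (gcd k (q ^ d - 1)) y dvd q ^ gcd d d' - 1"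
      using q d by (intro dvd_power_gcd_minus_one) (auto simp: d' intro: dvd_trans)
    also have "gcd d d' < d"
    proof -
      have "1 \<le> d'" "d' < d"
        using A d'(1) by auto
      thus ?thesis
        using gcd_le2_nat[of d' d] by linarith
    qed
    hence "q ^ gcd d d' - 1 dvd P"
      unfolding P_def by (intro dvd_prodI fin) auto
    finally show "gcd (gcd k (q ^ d - 1)) y dvd P" .
  qed
  ultimately have "gcd (gcd k (q ^ d - 1)) (Lcm ((\<lambda>d. gcd k (q ^ d - 1)) ` A)) \<le> P"
    by (intro dvd_imp_le)
  also have "P \<le> (\<Prod>e | e dvd d \<and> e < d. q ^ e)"
    unfolding P_def by (intro prod_mono) auto
  also have "\<dots> = q ^ aliquot_sum d"
    by (simp add: aliquot_sum_def power_sum)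
  finally show ?thesis .
qed

text \<open>Adjoining a new gcd \<open>g\<close> multiplies the least common multiple
  \<open>L\<close> by \<open>g / gcd g L\<close>, which is at least
  \<open>q powr (d / 3 - aliquot_sum d)\<close>.\<close>

lemma powr_sum_large_gcd_le_Lcm:
  "real q powr (\<Sum>d | d \<in> {1..N} \<and> odd d \<and> large_gcd d. real d / 3 - real (aliquot_sum d))
    \<le> real (Lcm ((\<lambda>d. gcd k (q ^ d - 1)) ` {d\<in>{1..N}. odd d \<and> large_gcd d}))"
proof (induction N)
  case (Suc N)
  let ?g = "\<lambda>d. gcd k (q ^ d - 1)"
  define B where "B = {d\<in>{1..N}. odd d \<and> large_gcd d}"
  define L where "L = Lcm (?g ` B)"
  define S where "S = (\<Sum>d\<in>B. real d / 3 - real (aliquot_sum d))"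
  have IH: "real q powr S \<le> real L"
    using Suc by (simp add: B_def L_def S_def)
  show ?case
  proof (cases "odd (Suc N) \<and> large_gcd (Suc N)")
    case False
    hence "{d\<in>{1..Suc N}. odd d \<and> large_gcd d} = B"
      unfolding B_def by (auto simp: le_Suc_eq)
    thus ?thesis
      using IH by (simp only: S_def L_def)
  next
    case True
    hence eq: "{d\<in>{1..Suc N}. odd d \<and> large_gcd d} = insert (Suc N) B"
      unfolding B_def by (auto simp: le_Suc_eq)
    have fin: "finite B" "Suc N \<notin> B"
      by (auto simp: B_def)
    define g where "g = ?g (Suc N)"
    have pos: "L > 0" "g > 0"
      using k fin by (auto simp: L_def g_def Lcm_0_iff intro!: Nat.gr0I)
    have "gcd g L \<le> q ^ aliquot_sum (Suc N)"
      unfolding g_def L_def by (rule gcd_with_earlier_le) (auto simp: B_def)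
    hence gcd_le: "real (gcd g L) \<le> real q powr aliquot_sum (Suc N)"
      using q by (simp add: powr_realpow flip: of_nat_power)
    have "real q powr (real (Suc N) / 3) * real q powr S \<le> real g * real L"
      using True IH by (intro mult_mono) (auto simp: large_gcd_def g_def)
    also have "\<dots> = real (gcd g L) * real (lcm g L)"
      by (metis of_nat_mult prod_gcd_lcm_nat)
    also have "\<dots> \<le> real q powr aliquot_sum (Suc N) * real (lcm g L)"
      using gcd_le by (intro mult_right_mono) auto
    finally have *: "real q powr (real (Suc N) / 3) * real q powr S
      \<le> real q powr aliquot_sum (Suc N) * real (lcm g L)" .
    have "real q powr (real (Suc N) / 3 - aliquot_sum (Suc N) + S) \<le> real (lcm g L)"
    proof -
      have "real q powr (real (Suc N) / 3 - aliquot_sum (Suc N) + S) =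
          real q powr (real (Suc N) / 3) * real q powr S / real q powr aliquot_sum (Suc N)"
        by (simp add: powr_add powr_diff)
      moreover have "real q powr aliquot_sum (Suc N) > 0"
        using q by simp
      ultimately show ?thesis
        using * by (simp only: pos_divide_le_eq mult.commute)
    qed
    moreover have "(\<Sum>d\<in>insert (Suc N) B. real d / 3 - real (aliquot_sum d)) =
        real (Suc N) / 3 - aliquot_sum (Suc N) + S"
      using fin by (simp add: S_def)
    moreover have "Lcm (?g ` insert (Suc N) B) = lcm g L"
      by (simp add: g_def L_def)
    ultimately show ?thesis
      by (simp only: eq)
  qed
qed simp

lemma sum_large_gcd_le:
  "(\<Sum>d | d \<in> {1..N} \<and> odd d \<and> large_gcd d. real d / 3 - real (aliquot_sum d)) \<le> log q k"
proof -
  let ?L = "Lcm ((\<lambda>d. gcd k (q ^ d - 1)) ` {d\<in>{1..N}. odd d \<and> large_gcd d})"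
  have "?L \<le> k"
    using k by (intro dvd_imp_le Lcm_least) auto
  hence "real q powr (\<Sum>d | d \<in> {1..N} \<and> odd d \<and> large_gcd d. real d / 3 - real (aliquot_sum d)) \<le> real k"
    using powr_sum_large_gcd_le_Lcm[of N] by linarith
  thus ?thesis
    using q k by (subst le_log_iff) auto
qed

end

section \<open>The average of the sum of proper divisors over odd numbers\<close>

lemma sum_odd: "(\<Sum>e::nat | e \<in> {1..M} \<and> odd e. e) = ((M + 1) div 2) ^ 2"
proof (induction M)
  case (Suc M)
  have "{e. e \<in> {1..Suc M} \<and> odd e} = (if odd (Suc M) then insert (Suc M) {e. e \<in> {1..M} \<and> odd e} else {e. e \<in> {1..M} \<and> odd e})"
    by (auto simp: le_Suc_eq)
  moreover have "finite {e. e \<in> {1..M} \<and> odd e}" "Suc M \<notin> {e. e \<in> {1..M} \<and> odd e}"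
    by auto
  ultimately have "(\<Sum>e | e \<in> {1..Suc M} \<and> odd e. e) = (if odd (Suc M) then Suc M else 0) + ((M + 1) div 2) ^ 2"
    using Suc by (cases "odd (Suc M)") (simp_all only: if_True if_False sum.insert add_0 not_False_eq_True)
  also have "\<dots> = ((Suc M + 1) div 2) ^ 2"
  proof (cases "even M")
    case True
    then obtain j where "M = 2 * j" by (elim evenE)
    thus ?thesis by (simp add: power2_eq_square)
  next
    case False
    then obtain j where "M = 2 * j + 1" by (elim oddE)
    thus ?thesis by simp
  qed
  finally show ?case .
qed simp

text \<open>Telescoping with \<open>1 / (2 * j + 1) ^ 2 \<le> 1 / (4 * j * (j + 1))\<close>. The
  resulting limit 1/4 is close to the true value \<open>pi^2 / 8 - 1\<close> and still below
  1/3.\<close>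

lemma sum_inverse_odd_squares_le: "(\<Sum>j=1..J. 1 / real (2 * j + 1) ^ 2) \<le> 1/4 - 1 / (4 * (real J + 1))"
proof (induction J)
  case (Suc J)
  have "1 / real (2 * Suc J + 1) ^ 2 \<le> 1 / (4 * (real J + 1) * (real J + 2))"
    by (intro divide_left_mono mult_pos_pos zero_less_power) (auto simp: power2_eq_square algebra_simps)
  also have "\<dots> = 1 / (4 * (real J + 1)) - 1 / (4 * (real (Suc J) + 1))"
    by (simp add: divide_simps)
  finally show ?case
    using Suc by simp
qed simp

text \<open>Write \<open>d = e * f\<close> with cofactor \<open>f = 2 * j + 1 \<ge> 3\<close>. The
  odd \<open>e \<le> N / f\<close> sum to about \<open>(N / f) ^ 2 / 4\<close>, and the inverse odd
  squares to at most 1/4, which gives \<open>N ^ 2 / 16\<close>; rounding costs the lower-order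
  term.\<close>

lemma sum_odd_aliquot_sum_le:
  assumes N: "N \<ge> 1"
  shows "(\<Sum>d | d \<in> {1..N} \<and> odd d. real (aliquot_sum d)) \<le> real N ^ 2 / 16 + real N / 4 * (2 + ln (real N))"
proof -
  have "(\<Sum>d | d \<in> {1..N} \<and> odd d. aliquot_sum d) =
    (\<Sum>(d,e)\<in>(SIGMA d:{d \<in> {1..N}. odd d}. {e. e dvd d \<and> e < d}). e)"
    unfolding aliquot_sum_def
    by (subst sum.Sigma) (auto intro: finite_subset[of _ "{..<_}"])
  also have "\<dots> \<le> (\<Sum>(j,e)\<in>(SIGMA j:{1..N}. {e \<in> {1..N div (2 * j + 1)}. odd e}). e)"
  proof (rule sum_le_included[where i = "\<lambda>(j,e). (e * (2 * j + 1), e)"])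
    show "\<forall>x\<in>(SIGMA d:{d \<in> {1..N}. odd d}. {e. e dvd d \<and> e < d}).
      \<exists>y\<in>(SIGMA j:{1..N}. {e \<in> {1..N div (2 * j + 1)}. odd e}).
        (case y of (j, e) \<Rightarrow> (e * (2 * j + 1), e)) = x \<and> (case x of (d, e) \<Rightarrow> e) \<le> (case y of (j, e) \<Rightarrow> e)"
    proof
      fix x assume "x \<in> (SIGMA d:{d \<in> {1..N}. odd d}. {e. e dvd d \<and> e < d})"
      then obtain d e where x: "x = (d, e)" and d: "d \<in> {1..N}" "odd d" and e: "e dvd d" "e < d"
        by auto
      then obtain f where f: "d = e * f" by (elim dvdE)
      have "odd e" "odd f"
        using d f by auto
      then obtain j where j: "f = 2 * j + 1" by (elim oddE)
      have "e \<ge> 1" "j \<ge> 1"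
        using \<open>odd e\<close> e f j by (auto simp: Suc_le_eq odd_pos intro!: Nat.gr0I)
      moreover have "j \<le> N"
      proof -
        have "j \<le> f" using j by simp
        also have "f \<le> e * f" using \<open>e \<ge> 1\<close> by simp
        finally show ?thesis using d f by simp
      qed
      moreover have "e \<le> N div (2 * j + 1)"
        using d f j by (simp add: less_eq_div_iff_mult_less_eq)
      ultimately show "\<exists>y\<in>(SIGMA j:{1..N}. {e \<in> {1..N div (2 * j + 1)}. odd e}).
        (case y of (j, e) \<Rightarrow> (e * (2 * j + 1), e)) = x \<and> (case x of (d, e) \<Rightarrow> e) \<le> (case y of (j, e) \<Rightarrow> e)"
        using \<open>odd e\<close> f j by (intro bexI[of _ "(j, e)"]) (auto simp: x)
    qed
  qed (auto intro!: finite_SigmaI intro: finite_subset[of _ "{..<_}"])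
  also have "\<dots> = (\<Sum>j=1..N. ((N div (2 * j + 1) + 1) div 2) ^ 2)"
    by (subst sum.Sigma[symmetric]) (simp_all only: sum_odd, auto)
  finally have "(\<Sum>d | d \<in> {1..N} \<and> odd d. real (aliquot_sum d)) \<le>
      real (\<Sum>j=1..N. ((N div (2 * j + 1) + 1) div 2) ^ 2)"
    by (simp only: of_nat_le_iff flip: of_nat_sum)
  also have "\<dots> \<le> (\<Sum>j=1..N. real N ^ 2 / 4 * (1 / real (2 * j + 1) ^ 2) + real N / 4 * (1 / real j) + 1 / 4)"
    unfolding of_nat_sum
  proof (rule sum_mono)
    fix j assume j: "j \<in> {1..N}"
    define f where "f = real (2 * j + 1)"
    have f: "f > 0" "1 / f \<le> 1 / (2 * real j)"
      using j by (auto simp: f_def field_simps)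
    have "real ((N div (2 * j + 1) + 1) div 2) \<le> (real N / f + 1) / 2"
    proof -
      have "real ((N div (2 * j + 1) + 1) div 2) \<le> real (N div (2 * j + 1) + 1) / 2"
        using of_nat_div_le_of_nat[of "N div (2 * j + 1) + 1" 2, where 'a=real] by simp
      moreover have "real (N div (2 * j + 1)) \<le> real N / f"
        unfolding f_def by (rule of_nat_div_le_of_nat)
      ultimately show ?thesis by simp
    qed
    hence "real ((N div (2 * j + 1) + 1) div 2) ^ 2 \<le> ((real N / f + 1) / 2) ^ 2"
      by (rule power_mono) simp
    also have "\<dots> = real N ^ 2 / 4 * (1 / f ^ 2) + real N / 2 * (1 / f) + 1 / 4"
      using f by (simp add: power2_eq_square field_simps)
    also have "real N / 2 * (1 / f) \<le> real N / 2 * (1 / (2 * real j))"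
      using f by (intro mult_left_mono) auto
    finally show "real (((N div (2 * j + 1) + 1) div 2) ^ 2) \<le>
        real N ^ 2 / 4 * (1 / real (2 * j + 1) ^ 2) + real N / 4 * (1 / real j) + 1 / 4"
      by (simp add: f_def)
  qed
  also have "\<dots> = real N ^ 2 / 4 * (\<Sum>j=1..N. 1 / real (2 * j + 1) ^ 2) + real N / 4 * (\<Sum>j=1..N. 1 / real j) + real N / 4"
    by (simp only: sum.distrib sum_distrib_left) simp
  also have "\<dots> \<le> real N ^ 2 / 4 * (1 / 4) + real N / 4 * (1 + ln (real N)) + real N / 4"
  proof (intro add_mono mult_left_mono order.refl harmonic_sum_le[OF N])
    have "1 / (4 * (real N + 1)) \<ge> 0" by simp
    thus "(\<Sum>j=1..N. 1 / real (2 * j + 1) ^ 2) \<le> 1 / 4"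
      using sum_inverse_odd_squares_le[of N] by linarith
  qed auto
  also have "\<dots> = real N ^ 2 / 16 + real N / 4 * (2 + ln (real N))"
    by (simp add: field_simps)
  finally show ?thesis .
qed

lemma eventually_sum_odd_defect_ge:
  "\<forall>\<^sub>F N in sequentially. real N ^ 2 / 100 \<le> (\<Sum>d | d \<in> {1..N} \<and> odd d. real d / 3 - real (aliquot_sum d))"
proof -
  \<comment> \<open>\<open>1/12\<close> comes from the odd \<open>d / 3\<close>, and
    \<open>1/12 - 1/16 = 1/48\<close>; the value \<open>1/100\<close> leaves room for the term of
    order \<open>N * ln N\<close>.\<close>
  have "\<forall>\<^sub>F N in sequentially. real N ^ 2 / 100 \<le> real N ^ 2 / 12 - (real N ^ 2 / 16 + real N / 4 * (2 + ln (real N)))"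
    by real_asymp
  thus ?thesis
    using eventually_ge_at_top[of 1]
  proof eventually_elim
    case (elim N)
    have "real N / 2 \<le> real ((N + 1) div 2)"
      by linarith
    hence "(real N / 2) ^ 2 \<le> real ((N + 1) div 2) ^ 2"
      by (rule power_mono) simp
    also have "\<dots> = real (\<Sum>d | d \<in> {1..N} \<and> odd d. d)"
      by (simp only: sum_odd of_nat_power)
    finally have "real N ^ 2 / 12 \<le> (\<Sum>d | d \<in> {1..N} \<and> odd d. real d / 3)"
      by (simp add: power2_eq_square flip: sum_divide_distrib)
    thus ?case
      using elim(1) sum_odd_aliquot_sum_le[OF elim(2)] unfolding sum_subtractf by linarith
  qed
qed

section \<open>Partial summation: from sums of degrees to sums of their reciprocals\<close>

lemma harmonic_tail_ge:
  assumes "1 \<le> M"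
  shows "M \<le> n + 1 \<Longrightarrow> ln ((real n + 1) / real M) \<le> (\<Sum>m=M..n. 1 / real m)"
proof (induction n)
  case 0
  thus ?case using assms by (cases "M = 1") auto
next
  case (Suc n)
  show ?case
  proof (cases "M = Suc n + 1")
    case True
    thus ?thesis by simp
  next
    case False
    hence M: "M \<le> Suc n" using Suc by simp
    have "ln ((real (Suc n) + 1) / real M) = ln ((real n + 1) / real M) + ln (1 + 1 / real (Suc n))"
    proof -
      have "1 + 1 / real (Suc n) = (real (Suc n) + 1) / (real n + 1)"
        by (simp add: divide_simps)
      hence "(real (Suc n) + 1) / real M = (real n + 1) / real M * (1 + 1 / real (Suc n))"
        by (simp add: add_nonneg_eq_0_iff)
      moreover have "(real n + 1) / real M > 0" "1 + 1 / real (Suc n) > 0"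
        using assms by (auto intro!: divide_pos_pos add_pos_nonneg)
      ultimately show ?thesis
        by (simp only: ln_mult_pos)
    qed
    also have "ln (1 + 1 / real (Suc n)) \<le> 1 / real (Suc n)"
      by (rule ln_add_one_self_le_self) simp
    finally show ?thesis
      using Suc.IH M by simp
  qed
qed

lemma sum_inverse_squares_tail_le: "1 \<le> d \<Longrightarrow> d \<le> n \<Longrightarrow> (\<Sum>N=d..n. 1 / real N ^ 2) \<le> 2 / real d - 1 / real n"
proof (induction n)
  case (Suc n)
  show ?case
  proof (cases "d = Suc n")
    case True
    have "1 / real d ^ 2 \<le> 1 / real d"
      using Suc.prems by (simp add: field_simps power2_eq_square)
    thus ?thesis using True by simp
  next
    case False
    hence d: "d \<le> n" "n \<ge> 1" using Suc.prems by auto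
    have "1 / real (Suc n) ^ 2 \<le> 1 / (real n * real (Suc n))"
      using d by (intro divide_left_mono) (auto simp: power2_eq_square)
    also have "\<dots> = 1 / real n - 1 / real (Suc n)"
      using d by (simp add: divide_simps)
    finally have "1 / real (Suc n) ^ 2 \<le> 1 / real n - 1 / real (Suc n)" .
    thus ?thesis
      using Suc.IH Suc.prems d by simp
  qed
qed simp

text \<open>The weights \<open>1 / (2 * N ^ 3)\<close> for \<open>N \<ge> d\<close> convert a
  contribution \<open>d\<close> to each of the sums up to \<open>N\<close> into at most
  \<open>1 / d\<close>.\<close>

lemma sum_inverse_cubes_le:
  assumes "1 \<le> d"
  shows "(\<Sum>N=d..n. real d / real N ^ 3) / 2 \<le> 1 / real d"
proof (cases "d \<le> n")
  case True
  have "(\<Sum>N=d..n. real d / real N ^ 3) \<le> (\<Sum>N=d..n. 1 / real N ^ 2)"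
  proof (rule sum_mono)
    fix N assume "N \<in> {d..n}"
    thus "real d / real N ^ 3 \<le> 1 / real N ^ 2"
      using assms by (simp add: field_simps power2_eq_square power3_eq_cube)
  qed
  also have "\<dots> \<le> 2 / real d"
    using sum_inverse_squares_tail_le[OF assms True] by (simp add: order.trans)
  finally show ?thesis by simp
qed simp

context
  fixes q k :: nat
  assumes q: "q \<ge> 2" and k: "k \<ge> 1"
begin

lemma sum_small_gcd_ge:
  assumes "real N ^ 2 / 100 \<le> (\<Sum>d | d \<in> {1..N} \<and> odd d. real d / 3 - real (aliquot_sum d))"
  shows "3 * (real N ^ 2 / 100 - log q k) \<le> (\<Sum>d | d \<in> {1..N} \<and> \<not> large_gcd q k d. real d)"
proof -
  let ?w = "\<lambda>d. real d / 3 - real (aliquot_sum d)"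
  have "(\<Sum>d | d \<in> {1..N} \<and> odd d. ?w d) =
    (\<Sum>d\<in>{d \<in> {1..N}. odd d \<and> large_gcd q k d} \<union> {d \<in> {1..N}. odd d \<and> \<not> large_gcd q k d}. ?w d)"
    by (rule sum.cong) auto
  also have "\<dots> = (\<Sum>d | d \<in> {1..N} \<and> odd d \<and> large_gcd q k d. ?w d) +
      (\<Sum>d | d \<in> {1..N} \<and> odd d \<and> \<not> large_gcd q k d. ?w d)"
    by (rule sum.union_disjoint) auto
  also have "\<dots> \<le> log q k + (\<Sum>d | d \<in> {1..N} \<and> \<not> large_gcd q k d. real d / 3)"
  proof (rule add_mono)
    have "(\<Sum>d | d \<in> {1..N} \<and> odd d \<and> \<not> large_gcd q k d. ?w d)
      \<le> (\<Sum>d | d \<in> {1..N} \<and> odd d \<and> \<not> large_gcd q k d. real d / 3)"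
      by (rule sum_mono) simp
    also have "\<dots> \<le> (\<Sum>d | d \<in> {1..N} \<and> \<not> large_gcd q k d. real d / 3)"
      by (rule sum_mono2) auto
    finally show "(\<Sum>d | d \<in> {1..N} \<and> odd d \<and> \<not> large_gcd q k d. ?w d)
      \<le> (\<Sum>d | d \<in> {1..N} \<and> \<not> large_gcd q k d. real d / 3)" .
  qed (rule sum_large_gcd_le[OF q k])
  also have "(\<Sum>d | d \<in> {1..N} \<and> \<not> large_gcd q k d. real d / 3) =
      (\<Sum>d | d \<in> {1..N} \<and> \<not> large_gcd q k d. real d) / 3"
    by (rule sum_divide_distrib[symmetric])
  finally have "real N ^ 2 / 100 \<le> log q k + (\<Sum>d | d \<in> {1..N} \<and> \<not> large_gcd q k d. real d) / 3"
    by (rule order.trans[OF assms])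
  thus ?thesis
    by simp
qed

text \<open>Sum \<open>sum_small_gcd_ge\<close> over \<open>M \<le> N \<le> n\<close> with weights
  \<open>1 / (2 * N ^ 3)\<close>, which produce the constants \<open>3 / 200\<close> and
  \<open>3 / 2\<close>, and exchange the order of summation. The terms with \<open>log q k\<close>
  number at most \<open>n\<close>, each with \<open>1 / N ^ 3 \<le> 1 / M ^ 3\<close>.\<close>

lemma sum_inverse_small_gcd_ge:
  assumes M: "1 \<le> M" "M \<le> n"
    and large: "\<And>N. N \<ge> M \<Longrightarrow>
      real N ^ 2 / 100 \<le> (\<Sum>d | d \<in> {1..N} \<and> odd d. real d / 3 - real (aliquot_sum d))"
  shows "3 / 200 * ln ((real n + 1) / real M) - 3 / 2 * log q k * real n / real M ^ 3
    \<le> (\<Sum>d | d \<in> {1..n} \<and> \<not> large_gcd q k d. 1 / real d)"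
proof -
  define G where "G = {d. \<not> large_gcd q k d}"
  have lk: "log q k \<ge> 0"
    using q k by simp
  have "3 / 200 * ln ((real n + 1) / real M) - 3 / 2 * log q k * real n / real M ^ 3
      \<le> 3 / 200 * (\<Sum>N=M..n. 1 / real N) - 3 / 2 * log q k * (\<Sum>N=M..n. 1 / real N ^ 3)"
  proof -
    have "(\<Sum>N=M..n. 1 / real N ^ 3) \<le> (\<Sum>N=M..n. 1 / real M ^ 3)"
      using M by (intro sum_mono divide_left_mono power_mono) auto
    also have "\<dots> \<le> real n * (1 / real M ^ 3)"
    proof -
      have "(\<Sum>N=M..n. 1 / real M ^ 3) = real (Suc n - M) * (1 / real M ^ 3)"
        by simp
      also have "\<dots> \<le> real n * (1 / real M ^ 3)"
        using M by (intro mult_right_mono) auto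
      finally show ?thesis .
    qed
    finally have "3 / 2 * log q k * (\<Sum>N=M..n. 1 / real N ^ 3) \<le> 3 / 2 * log q k * (real n * (1 / real M ^ 3))"
      using lk by (intro mult_left_mono) auto
    moreover have "ln ((real n + 1) / real M) \<le> (\<Sum>N=M..n. 1 / real N)"
      using M by (intro harmonic_tail_ge) auto
    moreover have "3 / 2 * log q k * (real n * (1 / real M ^ 3)) = 3 / 2 * log q k * real n / real M ^ 3"
      by simp
    ultimately show ?thesis by linarith
  qed
  also have "\<dots> = (\<Sum>N=M..n. 3 / 200 * (1 / real N) - 3 / 2 * log q k * (1 / real N ^ 3))"
    by (simp only: sum_distrib_left sum_subtractf)
  also have "\<dots> \<le> (\<Sum>N=M..n. (\<Sum>d\<in>{1..N} \<inter> G. real d) / real N ^ 3 / 2)"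
  proof (rule sum_mono)
    fix N assume N: "N \<in> {M..n}"
    have N0: "real N > 0" using N M by simp
    have "{1..N} \<inter> G = {d. d \<in> {1..N} \<and> \<not> large_gcd q k d}"
      by (auto simp: G_def)
    hence "3 * (real N ^ 2 / 100 - log q k) \<le> (\<Sum>d\<in>{1..N} \<inter> G. real d)"
      using sum_small_gcd_ge[OF large, of N] N by simp
    hence "3 * (real N ^ 2 / 100 - log q k) / real N ^ 3 / 2 \<le> (\<Sum>d\<in>{1..N} \<inter> G. real d) / real N ^ 3 / 2"
      using N0 by (intro divide_right_mono) auto
    moreover have "3 * (real N ^ 2 / 100 - log q k) / real N ^ 3 / 2 =
        3 / 200 * (1 / real N) - 3 / 2 * log q k * (1 / real N ^ 3)"
      using N0 by (simp add: field_simps power2_eq_square power3_eq_cube)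
    ultimately show "3 / 200 * (1 / real N) - 3 / 2 * log q k * (1 / real N ^ 3)
        \<le> (\<Sum>d\<in>{1..N} \<inter> G. real d) / real N ^ 3 / 2"
      by simp
  qed
  also have "\<dots> \<le> (\<Sum>N=1..n. (\<Sum>d\<in>{1..N} \<inter> G. real d) / real N ^ 3 / 2)"
    using M by (intro sum_mono2) (auto intro!: sum_nonneg divide_nonneg_nonneg)
  also have "\<dots> = (\<Sum>N=1..n. \<Sum>d\<in>{1..N} \<inter> G. real d / real N ^ 3 / 2)"
    by (simp add: sum_divide_distrib)
  also have "\<dots> = (\<Sum>d\<in>{1..n} \<inter> G. \<Sum>N=d..n. real d / real N ^ 3 / 2)"
    by (subst (1 2) sum.Sigma, simp, simp, simp, simp,
        rule sum.reindex_bij_witness[of _ "\<lambda>(d,N). (N,d)" "\<lambda>(N,d). (d,N)"]) auto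
  also have "\<dots> \<le> (\<Sum>d\<in>{1..n} \<inter> G. 1 / real d)"
    by (intro sum_mono sum_inverse_cubes_le[unfolded sum_divide_distrib]) auto
  also have "{1..n} \<inter> G = {d. d \<in> {1..n} \<and> \<not> large_gcd q k d}"
    by (auto simp: G_def)
  finally show ?thesis .
qed

end

theorem filterlim_sum_inverse_small_gcd:
  fixes k :: "nat \<Rightarrow> nat" and q :: nat
  assumes q: "q \<ge> 2" and k: "\<And>n. n \<ge> 1 \<Longrightarrow> k n \<ge> 1"
    and small: "(\<lambda>n. ln (real (k n))) \<in> o(\<lambda>n. real n ^ 2)"
  shows "filterlim (\<lambda>n. \<Sum>d | d \<in> {1..n} \<and> \<not> large_gcd q (k n) d. 1 / real d) at_top sequentially"
  unfolding filterlim_at_top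
proof
  fix Z :: real
  obtain N0 where N0: "\<And>N. N \<ge> N0 \<Longrightarrow>
      real N ^ 2 / 100 \<le> (\<Sum>d | d \<in> {1..N} \<and> odd d. real d / 3 - real (aliquot_sum d))"
    using eventually_sum_odd_defect_ge unfolding eventually_sequentially by blast
  \<comment> \<open>\<open>M\<close> will be about \<open>\<delta> * n\<close>, so the main term is
    at least \<open>3 / 200 * ln (1 / (2 * \<delta>))\<close>, hence at least \<open>Z + 1\<close>;
    the cap \<open>1/4\<close> keeps \<open>M \<le> n\<close>. The value of
    \<open>\<epsilon>\<close> is then the one that makes the error term at most 1.\<close>
  define \<delta> where "\<delta> = min (1/4) (exp (- 200 / 3 * (Z + 1)) / 2)"
  have \<delta>: "0 < \<delta>" "\<delta> \<le> 1/4" "\<delta> \<le> exp (- 200 / 3 * (Z + 1)) / 2"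
    by (auto simp: \<delta>_def)
  define \<epsilon> where "\<epsilon> = 2 / 3 * \<delta> ^ 3 * ln q"
  have lnq: "ln (real q) > 0" using q by simp
  have "\<epsilon> > 0" using \<delta> lnq by (simp add: \<epsilon>_def)
  from landau_o.smallD[OF small this]
  have "\<forall>\<^sub>F n in sequentially. ln (real (k n)) \<le> \<epsilon> * real n ^ 2"
    by eventually_elim simp
  moreover have "\<forall>\<^sub>F n in sequentially. \<delta> * real n \<ge> real (max 1 N0)"
    using \<delta>(1) by real_asymp
  ultimately show "\<forall>\<^sub>F n in sequentially. Z \<le> (\<Sum>d | d \<in> {1..n} \<and> \<not> large_gcd q (k n) d. 1 / real d)"
    using eventually_ge_at_top[of 1]
  proof eventually_elim
    case (elim n)
    define M where "M = nat \<lceil>\<delta> * real n\<rceil>"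
    have M_ge: "\<delta> * real n \<le> real M"
      unfolding M_def by linarith
    have M_le: "real M \<le> 2 * \<delta> * real n"
      using elim(2) unfolding M_def by linarith
    have "2 * \<delta> * real n \<le> real n"
      using \<delta> mult_right_mono[of "2 * \<delta>" 1 "real n"] by simp
    hence M: "1 \<le> M" "N0 \<le> M" "M \<le> n"
      using M_ge M_le elim(2) by linarith+
    have n0: "real n > 0" using elim by simp
    have "3 / 2 * log q (k n) * real n / real M ^ 3 \<le> 1"
    proof -
      have "log q (k n) \<le> 2 / 3 * \<delta> ^ 3 * real n ^ 2"
        using elim(1) lnq by (simp add: log_def \<epsilon>_def field_simps)
      hence "3 / 2 * log q (k n) * real n \<le> 3 / 2 * (2 / 3 * \<delta> ^ 3 * real n ^ 2) * real n"
        by (intro mult_right_mono mult_left_mono) auto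
      also have "\<dots> = (\<delta> * real n) ^ 3"
        by (simp add: power2_eq_square power3_eq_cube)
      also have "\<dots> \<le> real M ^ 3"
        using M_ge \<delta>(1) by (intro power_mono) auto
      finally show ?thesis
        using M by (simp add: divide_le_eq)
    qed
    moreover have "3 / 200 * ln ((real n + 1) / real M) \<ge> Z + 1"
    proof -
      have "exp (200 / 3 * (Z + 1)) \<le> 1 / (2 * \<delta>)"
        using \<delta> by (simp add: field_simps exp_minus)
      also have "\<dots> = real n / (2 * \<delta> * real n)"
        using n0 by simp
      also have "\<dots> \<le> (real n + 1) / real M"
        using M M_le n0 by (intro frac_le) auto
      finally have "200 / 3 * (Z + 1) \<le> ln ((real n + 1) / real M)"
        using M by (subst ln_ge_iff) auto
      thus ?thesis by simp
    qed
    moreover have "3 / 200 * ln ((real n + 1) / real M) - 3 / 2 * log q (k n) * real n / real M ^ 3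
        \<le> (\<Sum>d | d \<in> {1..n} \<and> \<not> large_gcd q (k n) d. 1 / real d)"
      using M N0 q k[OF elim(3)] by (intro sum_inverse_small_gcd_ge) auto
    ultimately show ?case by linarith
  qed
qed

text \<open>The lower limit is \<open>o(n)\<close>, so the sum eventually exceeds the logarithm of
  \<open>1 / \<delta>\<close> for any \<open>\<delta> > 0\<close>. The limit itself expresses
  \<open>k n \<le> q powr ((d - 11) / 2)\<close>, the condition of
  \<open>trace_deviation_bound_le_half\<close>.\<close>

lemma filterlim_sum_inverse_above_log:
  fixes k :: "nat \<Rightarrow> nat" and q :: nat
  assumes q: "q \<ge> 2" and k: "\<And>n. n \<ge> 1 \<Longrightarrow> k n \<ge> 1"
    and small: "(\<lambda>n. ln (real (k n))) \<in> o(\<lambda>n. real n)"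
  shows "filterlim (\<lambda>n. \<Sum>d | d \<in> {1..n} \<and> 2 * log q (k n) + 11 \<le> real d. 1 / real d) at_top sequentially"
  unfolding filterlim_at_top
proof
  fix Z :: real
  define \<delta> where "\<delta> = min 1 (exp (- Z))"
  have \<delta>: "0 < \<delta>" "\<delta> \<le> 1" "\<delta> \<le> exp (- Z)"
    by (auto simp: \<delta>_def)
  define \<epsilon> where "\<epsilon> = \<delta> / 4 * ln q"
  have lnq: "ln (real q) > 0" using q by simp
  have "\<epsilon> > 0" using \<delta> lnq by (simp add: \<epsilon>_def)
  from landau_o.smallD[OF small this]
  have "\<forall>\<^sub>F n in sequentially. ln (real (k n)) \<le> \<epsilon> * real n"
    by eventually_elim simp
  moreover have "\<forall>\<^sub>F n in sequentially. \<delta> / 2 * real n \<ge> 12"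
    using \<delta>(1) by real_asymp
  ultimately show "\<forall>\<^sub>F n in sequentially. Z \<le> (\<Sum>d | d \<in> {1..n} \<and> 2 * log q (k n) + 11 \<le> real d. 1 / real d)"
    using eventually_ge_at_top[of 1]
  proof eventually_elim
    case (elim n)
    define M where "M = nat \<lceil>2 * log q (k n) + 11\<rceil>"
    have lk: "log q (k n) \<ge> 0"
      using q k[OF elim(3)] by simp
    have M_ge: "2 * log q (k n) + 11 \<le> real M" and M_le: "real M \<le> 2 * log q (k n) + 12"
      using lk unfolding M_def by linarith+
    have "log q (k n) \<le> \<delta> / 4 * real n"
      using elim(1) lnq by (simp add: log_def \<epsilon>_def field_simps)
    hence M_le': "real M \<le> \<delta> * real n"
      using M_le elim(2) by linarith
    have n0: "real n > 0" using elim by simp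
    have "\<delta> * real n \<le> real n"
      using \<delta> n0 by simp
    hence M: "1 \<le> M" "M \<le> n + 1"
      using M_ge lk M_le' by linarith+
    have "exp Z \<le> 1 / \<delta>"
      using \<delta> by (simp add: field_simps exp_minus)
    also have "\<dots> = real n / (\<delta> * real n)"
      using n0 by simp
    also have "\<dots> \<le> (real n + 1) / real M"
      using M M_le' n0 by (intro frac_le) auto
    finally have "Z \<le> ln ((real n + 1) / real M)"
      using M by (subst ln_ge_iff) auto
    also have "\<dots> \<le> (\<Sum>m=M..n. 1 / real m)"
      using M by (intro harmonic_tail_ge) auto
    also have "\<dots> \<le> (\<Sum>d | d \<in> {1..n} \<and> 2 * log q (k n) + 11 \<le> real d. 1 / real d)"
      using M M_ge by (intro sum_mono2) auto
    finally show ?case .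
  qed
qed

section \<open>Equidistribution\<close>

text \<open>The number 11 is chosen so that the exponents \<open>(m - 11) / 2\<close> and
  \<open>(m + 3) / 2\<close> add up to \<open>m - 4\<close>: the factor 8 in front is then
  compensated by \<open>q ^ 4 \<ge> 16\<close>.\<close>

lemma trace_deviation_bound_le_half:
  fixes q g m :: nat
  assumes q: "q \<ge> 2" and g: "g \<ge> 1" "real g \<le> real q powr ((real m - 11) / 2)" and m: "m \<ge> 2"
  shows "4 * real (g + 1) * real q ^ (1 + m - m div 2) / real q ^ m \<le> 1 / 2"
proof -
  have q1: "real q \<ge> 1" "real q > 0"
    using q by simp_all
  have "2 * (1 + m - m div 2) \<le> m + 3"
    by presburger
  hence "real (2 * (1 + m - m div 2)) \<le> real (m + 3)"
    by (simp only: of_nat_le_iff)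
  hence "real (1 + m - m div 2) \<le> (real m + 3) / 2"
    by simp
  hence "real q ^ (1 + m - m div 2) \<le> real q powr ((real m + 3) / 2)"
    using q1 by (simp add: powr_mono flip: powr_realpow)
  moreover have "real (g + 1) \<le> 2 * real q powr ((real m - 11) / 2)"
    using g by simp
  ultimately have "4 * real (g + 1) * real q ^ (1 + m - m div 2) \<le>
      4 * (2 * real q powr ((real m - 11) / 2)) * real q powr ((real m + 3) / 2)"
    by (intro mult_mono) auto
  also have "\<dots> = 8 * real q powr (real m - 4)"
  proof -
    have "(real m - 11) / 2 + (real m + 3) / 2 = real m - 4"
      by (simp add: field_simps)
    thus ?thesis
      by (simp flip: powr_add)
  qed
  also have "\<dots> = 8 * (real q ^ m / real q ^ 4)"
    using q1 by (simp add: powr_diff powr_realpow)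
  also have "\<dots> \<le> 1 / 2 * real q ^ m"
  proof -
    have "(2::real) ^ 4 \<le> real q ^ 4"
      using q by (intro power_mono) auto
    hence "16 * real q ^ m \<le> real q ^ 4 * real q ^ m"
      by (intro mult_right_mono) auto
    thus ?thesis
      using q1 by (simp add: field_simps)
  qed
  finally show ?thesis
    using q1 by (simp add: divide_le_eq)
qed

lemma trace_deviation_monom_le_half:
  fixes k m :: nat
  assumes k: "k \<ge> 1" and m: "m \<ge> 33"
    and g: "real (gcd k (CARD('a) ^ m - 1)) < real CARD('a) powr (real m / 3)"
  shows "trace_deviation (monom (1::'a::{field,finite}) k) m \<le> 1/2"
proof -
  have q: "CARD('a) \<ge> 2"
    using CARD_finite_field_gt_1[where 'a='a] by simp
  have "real (gcd k (CARD('a) ^ m - 1)) \<le> real CARD('a) powr (real m / 3)"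
    using g by simp
  \<comment> \<open>\<open>m / 3 \<le> (m - 11) / 2\<close> amounts to
    \<open>m \<ge> 33\<close>.\<close>
  also have "\<dots> \<le> real CARD('a) powr ((real m - 11) / 2)"
    using q m by (intro powr_mono) auto
  finally have "4 * real (gcd k (CARD('a) ^ m - 1) + 1) * real CARD('a) ^ (1 + m - m div 2) / real CARD('a) ^ m \<le> 1/2"
    using q k m by (intro trace_deviation_bound_le_half) (auto simp: Suc_le_eq)
  thus ?thesis
    using trace_deviation_monom_le[OF k, of m, where 'a='a] m by linarith
qed

theorem theorem1p4:
  fixes k :: "nat \<Rightarrow> nat"
    and M :: "nat \<Rightarrow> 'w measure"
    and x :: "nat \<Rightarrow> nat \<Rightarrow> 'w \<Rightarrow> 'a::{field,finite} alg_closure"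
  assumes k_pos: "\<And>n. n \<ge> 1 \<Longrightarrow> k n > 0"
    and prob: "\<And>n. n \<ge> 1 \<Longrightarrow> prob_space (M n)"
    and rv: "\<And>n i. n \<ge> 1 \<Longrightarrow> i \<in> {1..n} \<Longrightarrow> x n i \<in> measurable (M n) (count_space UNIV)"
    and unif: "\<And>n. n \<ge> 1 \<Longrightarrow>
      uniformly_distributed_on (M n)
        (\<lambda>w. \<lambda>j\<in>{1..n}. elem_sym j n (\<lambda>i. x n i w))
        ({1..n} \<rightarrow>\<^sub>E base_field)"
  shows
    "((\<lambda>n. ln (real (k n))) \<in> o(\<lambda>n. real n ^ 2) \<longrightarrow>
        tends_to_uniform_on M (\<lambda>n w. power_sum (k n) n (\<lambda>i. x n i w)) base_field) \<and>
     (\<forall>a :: nat \<Rightarrow> nat \<Rightarrow> 'a.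
        (\<forall>n\<ge>1. a n (k n) \<noteq> 0) \<and> (\<forall>n\<ge>1. \<not> CHAR('a) dvd k n) \<and>
        (\<lambda>n. ln (real (k n))) \<in> o(\<lambda>n. real n) \<longrightarrow>
        tends_to_uniform_on M
          (\<lambda>n w. \<Sum>j=1..k n. to_ac (a n j) * power_sum j n (\<lambda>i. x n i w)) base_field) \<and>
     (filterlim
        (\<lambda>n. \<Sum>d | d \<in> {1..n} \<and> 12 * log (real CARD('a)) (real n) < real d \<and>
               real (gcd (k n) (CARD('a) ^ d - 1)) < real CARD('a) powr (real d / 3).
               1 / real d)
        at_top sequentially \<longrightarrow>
        tends_to_uniform_on M (\<lambda>n w. power_sum (k n) n (\<lambda>i. x n i w)) base_field)"
proof (intro conjI impI allI)
  have q: "CARD('a) \<ge> 2"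
    using CARD_finite_field_gt_1[where 'a='a] by simp
  have k1: "k n \<ge> 1" if "n \<ge> 1" for n
    using k_pos[OF that] by simp
  note uniformI = tends_to_uniform_if_deviation_small[where M=M and x=x, OF prob rv unif]
  have power_sum_eval: "power_sum j n (\<lambda>i. x n i w) = (\<Sum>i\<in>{1..n}. ac_eval (monom 1 j) (x n i w))" for j n w
    by (simp add: power_sum_def)
  {
    assume small: "(\<lambda>n. ln (real (k n))) \<in> o(\<lambda>n. real n ^ 2)"
    show "tends_to_uniform_on M (\<lambda>n w. power_sum (k n) n (\<lambda>i. x n i w)) base_field"
    proof (rule uniformI[where h = "\<lambda>n. monom 1 (k n)"])
      let ?S = "\<lambda>n. \<Sum>d | d \<in> {1..n} \<and> \<not> large_gcd CARD('a) (k n) d. 1 / real d"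
      \<comment> \<open>The degrees up to 32, to which \<open>trace_deviation_monom_le_half\<close>
        does not apply, contribute at most 1 each.\<close>
      have "filterlim (\<lambda>n. -32 + ?S n) at_top sequentially"
        by (intro filterlim_tendsto_add_at_top[OF tendsto_const] filterlim_sum_inverse_small_gcd q k1 small)
      moreover have "\<forall>\<^sub>F n in sequentially. -32 + ?S n \<le>
          (\<Sum>m | m \<in> {1..n} \<and> trace_deviation (monom (1::'a) (k n)) m \<le> 1/2. 1 / real m)"
        using eventually_ge_at_top[of 1]
      proof eventually_elim
        case (elim n)
        let ?A = "{d. d \<in> {1..n} \<and> \<not> large_gcd CARD('a) (k n) d}"
        have "?S n = (\<Sum>d\<in>?A \<inter> {1..32}. 1 / real d) + (\<Sum>d\<in>?A - {1..32}. 1 / real d)"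
          by (rule sum.Int_Diff) auto
        moreover have "(\<Sum>d\<in>?A \<inter> {1..32}. 1 / real d) \<le> (\<Sum>d\<in>{1..32::nat}. 1)"
          by (rule sum_le_included[where i = id]) auto
        moreover have "(\<Sum>d\<in>?A - {1..32}. 1 / real d) \<le>
          (\<Sum>m | m \<in> {1..n} \<and> trace_deviation (monom (1::'a) (k n)) m \<le> 1/2. 1 / real m)"
        proof (rule sum_mono2)
          show "?A - {1..32} \<subseteq> {m. m \<in> {1..n} \<and> trace_deviation (monom (1::'a) (k n)) m \<le> 1/2}"
            using trace_deviation_monom_le_half[OF k1[OF elim], where 'a='a]
            by (auto simp: large_gcd_def[OF q k1[OF elim]] not_le)
        qed auto
        ultimately show ?case by simp
      qed
      ultimately show "filterlim (\<lambda>n. \<Sum>m | m \<in> {1..n} \<and> trace_deviation (monom (1::'a) (k n)) m \<le> 1/2. 1 / real m) at_top sequentially"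
        by (rule filterlim_at_top_mono)
    qed (auto simp: power_sum_eval)
  next
    fix a :: "nat \<Rightarrow> nat \<Rightarrow> 'a"
    assume "(\<forall>n\<ge>1. a n (k n) \<noteq> 0) \<and> (\<forall>n\<ge>1. \<not> CHAR('a) dvd k n) \<and> (\<lambda>n. ln (real (k n))) \<in> o(\<lambda>n. real n)"
    hence a: "\<And>n. n \<ge> 1 \<Longrightarrow> a n (k n) \<noteq> 0" and p: "\<And>n. n \<ge> 1 \<Longrightarrow> \<not> CHAR('a) dvd k n"
      and small: "(\<lambda>n. ln (real (k n))) \<in> o(\<lambda>n. real n)"
      by auto
    define h where "h = (\<lambda>n. \<Sum>j=1..k n. monom (a n j) j)"
    show "tends_to_uniform_on M (\<lambda>n w. \<Sum>j=1..k n. to_ac (a n j) * power_sum j n (\<lambda>i. x n i w)) base_field"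
    proof (rule uniformI[where h = h])
      fix n w
      have "(\<Sum>j=1..k n. to_ac (a n j) * power_sum j n (\<lambda>i. x n i w)) =
        (\<Sum>j=1..k n. \<Sum>i=1..n. to_ac (a n j) * x n i w ^ j)"
        by (simp add: power_sum_def sum_distrib_left)
      also have "\<dots> = (\<Sum>i\<in>{1..n}. ac_eval (h n) (x n i w))"
        by (subst sum.swap) (simp add: h_def ac_eval_sum)
      finally show "(\<Sum>j=1..k n. to_ac (a n j) * power_sum j n (\<lambda>i. x n i w)) =
        (\<Sum>i\<in>{1..n}. ac_eval (h n) (x n i w))" .
    next
      let ?S = "\<lambda>n. \<Sum>d | d \<in> {1..n} \<and> 2 * log CARD('a) (k n) + 11 \<le> real d. 1 / real d"
      have "filterlim ?S at_top sequentially"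
        by (intro filterlim_sum_inverse_above_log q k1 small)
      moreover have "\<forall>\<^sub>F n in sequentially. ?S n \<le> (\<Sum>m | m \<in> {1..n} \<and> trace_deviation (h n) m \<le> 1/2. 1 / real m)"
        using eventually_ge_at_top[of 1]
      proof eventually_elim
        case (elim n)
        \<comment> \<open>The nonzero top coefficient makes the degree exactly \<open>k n\<close>,
          and the characteristic not dividing \<open>k n\<close> makes it prime to \<open>q\<close>,
          as Stepanov's bound for a general polynomial requires.\<close>
        have "coeff (h n) (k n) = a n (k n)"
          using k1[OF elim] by (simp add: h_def coeff_sum coeff_monom)
        hence "k n \<le> degree (h n)"
          using a[OF elim] by (intro le_degree) simp
        moreover have "degree (h n) \<le> k n"
          unfolding h_def by (intro degree_sum_le) (auto intro: order.trans[OF degree_monom_le])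
        ultimately have deg: "degree (h n) = k n" by simp
        have cop: "coprime (k n) CARD('a)"
          using p[OF elim] by (simp add: coprime_CARD_iff)
        have "trace_deviation (h n) m \<le> 1/2" if m: "2 * log CARD('a) (k n) + 11 \<le> real m" for m
        proof -
          have lk: "log CARD('a) (k n) \<ge> 0"
            using q k1[OF elim] by simp
          hence m2: "m \<ge> 2" using m by linarith
          have "real (k n) = real CARD('a) powr log CARD('a) (k n)"
            using q k1[OF elim] by simp
          also have "\<dots> \<le> real CARD('a) powr ((real m - 11) / 2)"
            using m q by (intro powr_mono) auto
          finally have "4 * real (k n + 1) * real CARD('a) ^ (1 + m - m div 2) / real CARD('a) ^ m \<le> 1/2"
            using q k1[OF elim] m2 by (intro trace_deviation_bound_le_half) auto
          thus ?thesis
            using trace_deviation_le[OF deg k1[OF elim] cop m2] by linarith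
        qed
        thus ?case
          by (intro sum_mono2) auto
      qed
      ultimately show "filterlim (\<lambda>n. \<Sum>m | m \<in> {1..n} \<and> trace_deviation (h n) m \<le> 1/2. 1 / real m) at_top sequentially"
        by (rule filterlim_at_top_mono)
    qed auto
  next
    let ?S = "\<lambda>n. \<Sum>d | d \<in> {1..n} \<and> 12 * log (real CARD('a)) (real n) < real d \<and>
               real (gcd (k n) (CARD('a) ^ d - 1)) < real CARD('a) powr (real d / 3). 1 / real d"
    assume lim: "filterlim ?S at_top sequentially"
    show "tends_to_uniform_on M (\<lambda>n w. power_sum (k n) n (\<lambda>i. x n i w)) base_field"
    proof (rule uniformI[where h = "\<lambda>n. monom 1 (k n)"])
      \<comment> \<open>The lower limit of the sum tends to infinity, so eventually all
        \<open>d\<close> counted pass the threshold 33 of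
        \<open>trace_deviation_monom_le_half\<close>.\<close>
      have "filterlim (\<lambda>n. 12 * log (real CARD('a)) (real n)) at_top sequentially"
      proof -
        have "ln (real CARD('a)) > 0"
          using q by simp
        thus ?thesis
          unfolding log_def by real_asymp
      qed
      hence "\<forall>\<^sub>F n in sequentially. 33 \<le> 12 * log (real CARD('a)) (real n)"
        unfolding filterlim_at_top by (rule spec)
      hence "\<forall>\<^sub>F n in sequentially. ?S n \<le>
          (\<Sum>m | m \<in> {1..n} \<and> trace_deviation (monom (1::'a) (k n)) m \<le> 1/2. 1 / real m)"
        using eventually_ge_at_top[of 1]
      proof eventually_elim
        case (elim n)
        thus ?case
          using trace_deviation_monom_le_half[OF k1[OF elim(2)], where 'a='a] by (intro sum_mono2) auto
      qed
      with lim show "filterlim (\<lambda>n. \<Sum>m | m \<in> {1..n} \<and> trace_deviation (monom (1::'a) (k n)) m \<le> 1/2. 1 / real m) at_top sequentially"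
        by (rule filterlim_at_top_mono)
    qed (auto simp: power_sum_eval)
  }
qed

end
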